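(* Let $(V;\rho,\theta,D,R_V)$ be a representation of a modified Rota-Baxter Lie-Yamaguti algebra $(\mathfrak{L},[-,-],\{-,-,-\},R)$. Then the maps $\mathrm{d}^{n}:\mathcal{C}^{n}_{\mathrm{MRBLY}}(\mathfrak{L},V)\to\mathcal{C}^{n+1}_{\mathrm{MRBLY}}(\mathfrak{L},V)$ form a coboundary operator, i.e. $\mathrm{d}^{n+1}\circ\mathrm{d}^{n}=0$ for all $n\ge 1$.
   Context: Throughout, $\mathbb{K}$ is an algebraically closed field of characteristic zero; all vector spaces and (multi)linear maps are over $\mathbb{K}$. A Lie-Yamaguti algebra is a triple $(\mathfrak{L},[-,-],\{-,-,-\})$ of a vector space with a bilinear and a trilinear operation such that for all $x,y,z,a,b\in\mathfrak{L}$: (LY1) $[x,y]=-[y,x]$; (LY2) $\{x,y,z\}=-\{y,x,z\}$; (LY3) $[[x,y],z]+[[y,z],x]+[[z,x],y]+\{x,y,z\}+\{y,z,x\}+\{z,x,y\}=0$; (LY4) $\{[x,y],z,a\}+\{[z,x],y,a\}+\{[y,z],x,a\}=0$; (LY5) $\{a,b,[x,y]\}=[\{a,b,x\},y]+[x,\{a,b,y\}]$; (LY6) $\{a,b,\{x,y,z\}\}=\{\{a,b,x\},y,z\}+\{x,\{a,b,y\},z\}+\{x,y,\{a,b,z\}\}$. A modified Rota-Baxter Lie-Yamaguti algebra is a Lie-Yamaguti algebra with a linear map $R:\mathfrak{L}\to\mathfrak{L}$ such that $[Rx,Ry]=R([Rx,y]+[x,Ry])-[x,y]$ and $\{Rx,Ry,Rz\}=R(\{x,Ry,Rz\}+\{Rx,y,Rz\}+\{Rx,Ry,z\}+\{x,y,z\})-\{Rx,y,z\}-\{x,Ry,z\}-\{x,y,Rz\}$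 for all $x,y,z$. A representation $(V;\rho,\theta,D)$ of a Lie-Yamaguti algebra $\mathfrak{L}$ consists of a vector space $V$, a linear map $\rho:\mathfrak{L}\to\mathfrak{gl}(V)$ and bilinear maps $\theta,D:\mathfrak{L}\times\mathfrak{L}\to\mathfrak{gl}(V)$ such that for all $x,y,z,a,b\in\mathfrak{L}$: (R1) $D(x,y)-\theta(y,x)+\theta(x,y)+\rho([x,y])-\rho(x)\rho(y)+\rho(y)\rho(x)=0$; (R2) $D([x,y],z)+D([y,z],x)+D([z,x],y)=0$; (R3) $\theta([x,y],a)=\theta(x,a)\rho(y)-\theta(y,a)\rho(x)$; (R4) $D(a,b)\rho(x)=\rho(x)D(a,b)+\rho(\{a,b,x\})$; (R5) $\theta(x,[a,b])=\rho(a)\theta(x,b)-\rho(b)\theta(x,a)$; (R6) $D(a,b)\theta(x,y)=\theta(x,y)D(a,b)+\theta(\{a,b,x\},y)+\theta(x,\{a,b,y\})$; (R7) $\theta(a,\{x,y,z\})=\theta(y,z)\theta(a,x)-\theta(x,z)\theta(a,y)+D(x,y)\theta(a,z)$. A representation $(V;\rho,\theta,D,R_V)$ of $(\mathfrak{L},[-,-],\{-,-,-\},R)$ is a representation $(V;\rho,\theta,D)$ of the Lie-Yamaguti algebra with a linear map $R_V:V\to V$ such that for all $x,y\in\mathfrak{L}$, $u\in V$: $\rho(Rx)R_Vu=R_V(\rho(Rx)u+\rho(x)R_Vu)-\rho(x)u$, $\theta(Rx,Ry)R_Vu=R_V(\theta(Rx,Ry)u+\theta(Rx,y)R_Vu+\theta(x,Ry)R_Vu+\theta(x,y)u)-\theta(Rx,y)u-\theta(x,y)R_Vu-\theta(x,Ry)u$.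 Yamaguti cochains: $\mathcal{C}^1_{\mathrm{LY}}(\mathfrak{L},V)=\mathrm{Hom}(\mathfrak{L},V)$ and, for $n\ge1$, $\mathcal{C}^{n+1}_{\mathrm{LY}}(\mathfrak{L},V)=\mathrm{Hom}((\wedge^2\mathfrak{L})^{\otimes n},V)\times\mathrm{Hom}((\wedge^2\mathfrak{L})^{\otimes n}\otimes\mathfrak{L},V)$. The map $\delta^{n+1}=(\delta^{n+1}_I,\delta^{n+1}_{II}):\mathcal{C}^{n+1}_{\mathrm{LY}}\to\mathcal{C}^{n+2}_{\mathrm{LY}}$ is, for $n\ge1$, $\mathfrak{K}_i=x_i\wedge y_i$, $z\in\mathfrak{L}$ (hat denotes omission): $\delta^{n+1}_I(f,g)(\mathfrak{K}_1,\dots,\mathfrak{K}_{n+1})=(-1)^n\big(\rho(x_{n+1})g(\mathfrak{K}_1,\dots,\mathfrak{K}_n,y_{n+1})-\rho(y_{n+1})g(\mathfrak{K}_1,\dots,\mathfrak{K}_n,x_{n+1})-g(\mathfrak{K}_1,\dots,\mathfrak{K}_n,[x_{n+1},y_{n+1}])\big)+\sum_{k=1}^{n}(-1)^{k+1}D(\mathfrak{K}_k)f(\mathfrak{K}_1,\dots,\widehat{\mathfrak{K}_k},\dots,\mathfrak{K}_{n+1})+\sum_{1\le k<l\le n+1}(-1)^kf(\mathfrak{K}_1,\dots,\widehat{\mathfrak{K}_k},\dots,\{x_k,y_k,x_l\}\wedge y_l+x_l\wedge\{x_k,y_k,y_l\},\dots,\mathfrak{K}_{n+1})$ (the modified entry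 is in the $l$-th place); $\delta^{n+1}_{II}(f,g)(\mathfrak{K}_1,\dots,\mathfrak{K}_{n+1},z)=(-1)^n\big(\theta(y_{n+1},z)g(\mathfrak{K}_1,\dots,\mathfrak{K}_n,x_{n+1})-\theta(x_{n+1},z)g(\mathfrak{K}_1,\dots,\mathfrak{K}_n,y_{n+1})\big)+\sum_{k=1}^{n+1}(-1)^{k+1}D(\mathfrak{K}_k)g(\mathfrak{K}_1,\dots,\widehat{\mathfrak{K}_k},\dots,\mathfrak{K}_{n+1},z)+\sum_{1\le k<l\le n+1}(-1)^kg(\mathfrak{K}_1,\dots,\widehat{\mathfrak{K}_k},\dots,\{x_k,y_k,x_l\}\wedge y_l+x_l\wedge\{x_k,y_k,y_l\},\dots,\mathfrak{K}_{n+1},z)+\sum_{k=1}^{n+1}(-1)^kg(\mathfrak{K}_1,\dots,\widehat{\mathfrak{K}_k},\dots,\mathfrak{K}_{n+1},\{x_k,y_k,z\})$. For $n=0$: $\delta^1_I(f)(x,y)=\rho(x)f(y)-\rho(y)f(x)-f([x,y])$, $\delta^1_{II}(f)(x,y,z)=D(x,y)f(z)+\theta(y,z)f(x)-\theta(x,z)f(y)-f(\{x,y,z\})$. The complex of the operator: $\mathcal{C}^{n}_{\mathrm{MRBO}}(\mathfrak{L},V):=\mathcal{C}^{n}_{\mathrm{LY}}(\mathfrak{L},V)$ as a space, and $\partial^n$ is given by the same formulas as $\delta^n$ with $[-,-],\{-,-,-\},\rho,\theta,D$ replaced by $[-,-]_R,\{-,-,-\}_R,\rho_R,\theta_R,D_R$,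 where $[x,y]_R=[Rx,y]+[x,Ry]$, $\{x,y,z\}_R=\{x,Ry,Rz\}+\{Rx,y,Rz\}+\{Rx,Ry,z\}+\{x,y,z\}$, $\rho_R(x)u=\rho(Rx)u-R_V(\rho(x)u)$, $\theta_R(x,y)u=\theta(Rx,Ry)u+\theta(Rx,y)u+\theta(x,Ry)u-R_V(\theta(x,y)u)$, $D_R(x,y)u=D(Rx,Ry)u+D(Rx,y)u+D(x,Ry)u-R_V(D(x,y)u)$. The map $\Phi^{n+1}:\mathcal{C}^{n+1}_{\mathrm{LY}}(\mathfrak{L},V)\to\mathcal{C}^{n+1}_{\mathrm{MRBO}}(\mathfrak{L},V)$: $\Phi^1(f)=f\circ R-R_V\circ f$; for $n\ge1$, $\Phi^{n+1}(f,g)=(\Phi^{n+1}_I(f),\Phi^{n+1}_{II}(g))$. Regard $f$ as a function of $2n$ arguments and $g$ as a function of $2n+1$ arguments in $\mathfrak{L}$, and for a subset $S$ of argument positions let $f^S$, $g^S$ be obtained by applying $R$ to the arguments in positions $S$. Then $\Phi^{n+1}_I(f)=\sum_{|S|\text{ even}}f^S-R_V\circ\sum_{|S|\text{ odd}}f^S$ over $S\subseteq\{1,\dots,2n\}$, and $\Phi^{n+1}_{II}(g)=\sum_{|S|\text{ odd}}g^S-R_V\circ\sum_{|S|\text{ even}}g^S$ over $S\subseteq\{1,\dots,2n+1\}$. The complex of the algebra: $\mathcal{C}^1_{\mathrm{MRBLY}}(\mathfrak{L},V)=\mathcal{C}^1_{\mathrm{LY}}(\mathfrak{L},V)$ and $\mathcal{C}^{n+1}_{\mathrm{MRBLY}}(\mathfrak{L},V)=\mathcal{C}^{n+1}_{\mathrm{LY}}(\mathfrak{L},V)\oplus\mathcal{C}^{n}_{\mathrm{MRBO}}(\mathfrak{L},V)$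 for $n\ge1$; $\mathrm{d}^1(f_1)=(\delta^1f_1,-\Phi^1(f_1))$; $\mathrm{d}^2((f_1,g_1),f_2)=(\delta^2(f_1,g_1),-\partial^1(f_2)-\Phi^2(f_1,g_1))$; and for $n\ge2$, $\mathrm{d}^{n+1}((f_1,g_1),(f_2,g_2))=(\delta^{n+1}(f_1,g_1),-\partial^n(f_2,g_2)-\Phi^{n+1}(f_1,g_1))$.
   Formalization: The induced maps θ_R and D_R are corrected to T_R(x,y)u = T(Rx,Ry)u + T(x,y)u − R_V(T(Rx,y)u + T(x,Ry)u) for T = θ, D; with the formulas as printed, the operator complex does not satisfy ∂∂ = 0. *)

theory Defs
  imports
    "HOL-Library.Function_Algebras"
    "HOL-Library.Product_Plus"
    "HOL-Computational_Algebra.Polynomial"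
begin

section \<open>Modified Rota-Baxter Lie-Yamaguti algebras and their representations\<close>

text \<open>
  Vector spaces are types with an explicit scalar multiplication (locale \<^locale>\<open>vector_space\<close>).
  An element of \<open>gl(V)\<close> is a linear function on the type of \<open>V\<close>, and a (bi)linear map into \<open>gl(V)\<close>
  is a curried function that is linear in every argument.
\<close>

locale lie_yamaguti = vector_space sL
  for sL :: "'k::{alg_closed_field,field_char_0} \<Rightarrow> 'l::ab_group_add \<Rightarrow> 'l" +
  fixes br :: "'l \<Rightarrow> 'l \<Rightarrow> 'l"
    and tri :: "'l \<Rightarrow> 'l \<Rightarrow> 'l \<Rightarrow> 'l"
  assumes br_linear1: "Vector_Spaces.linear sL sL (\<lambda>x. br x y)"
    and br_linear2: "Vector_Spaces.linear sL sL (\<lambda>y. br x y)"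
    and tri_linear1: "Vector_Spaces.linear sL sL (\<lambda>x. tri x y z)"
    and tri_linear2: "Vector_Spaces.linear sL sL (\<lambda>y. tri x y z)"
    and tri_linear3: "Vector_Spaces.linear sL sL (\<lambda>z. tri x y z)"
    and LY1: "br x y = - br y x"
    and LY2: "tri x y z = - tri y x z"
    and LY3: "br (br x y) z + br (br y z) x + br (br z x) y + tri x y z + tri y z x + tri z x y = 0"
    and LY4: "tri (br x y) z a + tri (br z x) y a + tri (br y z) x a = 0"
    and LY5: "tri a b (br x y) = br (tri a b x) y + br x (tri a b y)"
    and LY6: "tri a b (tri x y z) =
                tri (tri a b x) y z + tri x (tri a b y) z + tri x y (tri a b z)"

locale modified_rb_lie_yamaguti = lie_yamaguti sL br tri
  for sL :: "'k::{alg_closed_field,field_char_0} \<Rightarrow> 'l::ab_group_add \<Rightarrow> 'l"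
    and br :: "'l \<Rightarrow> 'l \<Rightarrow> 'l"
    and tri :: "'l \<Rightarrow> 'l \<Rightarrow> 'l \<Rightarrow> 'l" +
  fixes R :: "'l \<Rightarrow> 'l"
  assumes R_linear: "Vector_Spaces.linear sL sL R"
    and R_br: "br (R x) (R y) = R (br (R x) y + br x (R y)) - br x y"
    and R_tri: "tri (R x) (R y) (R z) =
                  R (tri x (R y) (R z) + tri (R x) y (R z) + tri (R x) (R y) z + tri x y z)
                  - tri (R x) y z - tri x (R y) z - tri x y (R z)"

locale ly_representation = lie_yamaguti sL br tri + V: vector_space sV
  for sL :: "'k::{alg_closed_field,field_char_0} \<Rightarrow> 'l::ab_group_add \<Rightarrow> 'l"
    and br :: "'l \<Rightarrow> 'l \<Rightarrow> 'l"
    and tri :: "'l \<Rightarrow> 'l \<Rightarrow> 'l \<Rightarrow> 'l"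
    and sV :: "'k \<Rightarrow> 'v::ab_group_add \<Rightarrow> 'v" +
  fixes rho :: "'l \<Rightarrow> 'v \<Rightarrow> 'v"
    and theta :: "'l \<Rightarrow> 'l \<Rightarrow> 'v \<Rightarrow> 'v"
    and D :: "'l \<Rightarrow> 'l \<Rightarrow> 'v \<Rightarrow> 'v"
  assumes rho_gl: "Vector_Spaces.linear sV sV (rho x)"
    and theta_gl: "Vector_Spaces.linear sV sV (theta x y)"
    and D_gl: "Vector_Spaces.linear sV sV (D x y)"
    and rho_linear: "Vector_Spaces.linear sL sV (\<lambda>x. rho x u)"
    and theta_linear1: "Vector_Spaces.linear sL sV (\<lambda>x. theta x y u)"
    and theta_linear2: "Vector_Spaces.linear sL sV (\<lambda>y. theta x y u)"
    and D_linear1: "Vector_Spaces.linear sL sV (\<lambda>x. D x y u)"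
    and D_linear2: "Vector_Spaces.linear sL sV (\<lambda>y. D x y u)"
    and R1: "D x y u - theta y x u + theta x y u + rho (br x y) u
               - rho x (rho y u) + rho y (rho x u) = 0"
    and R2: "D (br x y) z u + D (br y z) x u + D (br z x) y u = 0"
    and R3: "theta (br x y) a u = theta x a (rho y u) - theta y a (rho x u)"
    and R4: "D a b (rho x u) = rho x (D a b u) + rho (tri a b x) u"
    and R5: "theta x (br a b) u = rho a (theta x b u) - rho b (theta x a u)"
    and R6: "D a b (theta x y u) =
               theta x y (D a b u) + theta (tri a b x) y u + theta x (tri a b y) u"
    and R7: "theta a (tri x y z) u =
               theta y z (theta a x u) - theta x z (theta a y u) + D x y (theta a z u)"

locale modified_rb_ly_representation =
  modified_rb_lie_yamaguti sL br tri R + ly_representation sL br tri sV rho theta D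
  for sL :: "'k::{alg_closed_field,field_char_0} \<Rightarrow> 'l::ab_group_add \<Rightarrow> 'l"
    and br :: "'l \<Rightarrow> 'l \<Rightarrow> 'l"
    and tri :: "'l \<Rightarrow> 'l \<Rightarrow> 'l \<Rightarrow> 'l"
    and R :: "'l \<Rightarrow> 'l"
    and sV :: "'k \<Rightarrow> 'v::ab_group_add \<Rightarrow> 'v"
    and rho :: "'l \<Rightarrow> 'v \<Rightarrow> 'v"
    and theta :: "'l \<Rightarrow> 'l \<Rightarrow> 'v \<Rightarrow> 'v"
    and D :: "'l \<Rightarrow> 'l \<Rightarrow> 'v \<Rightarrow> 'v" +
  fixes RV :: "'v \<Rightarrow> 'v"
  assumes RV_linear: "Vector_Spaces.linear sV sV RV"
    and RV_rho: "rho (R x) (RV u) = RV (rho (R x) u + rho x (RV u)) - rho x u"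
    and RV_theta: "theta (R x) (R y) (RV u) =
                     RV (theta (R x) (R y) u + theta (R x) y (RV u) + theta x (R y) (RV u)
                         + theta x y u)
                     - theta (R x) y u - theta x y (RV u) - theta x (R y) u"


section \<open>The Yamaguti complex\<close>

text \<open>
  A linear map on the \<open>n\<close>-th tensor power of the exterior square of \<open>L\<close> is a function on lists of
  \<open>n\<close> pairs, the pair \<open>(x, y)\<close> standing for the wedge product of \<open>x\<close> and \<open>y\<close>, which is bilinear
  and alternating in each pair. It is extended by \<open>0\<close> to lists of other lengths, so that equal maps
  are equal functions.
\<close>

definition wedge_hom ::
  "('k::field \<Rightarrow> 'l::ab_group_add \<Rightarrow> 'l) \<Rightarrow> ('k \<Rightarrow> 'v::ab_group_add \<Rightarrow> 'v) \<Rightarrow> nat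
    \<Rightarrow> (('l \<times> 'l) list \<Rightarrow> 'v) set" where
  "wedge_hom sL sV n = {f.
     (\<forall>Ks. length Ks \<noteq> n \<longrightarrow> f Ks = 0) \<and>
     (\<forall>Ks i. length Ks = n \<and> i < n \<longrightarrow>
        (\<forall>y. Vector_Spaces.linear sL sV (\<lambda>x. f (Ks[i := (x, y)]))) \<and>
        (\<forall>x. Vector_Spaces.linear sL sV (\<lambda>y. f (Ks[i := (x, y)]))) \<and>
        (\<forall>x. f (Ks[i := (x, x)]) = 0))}"

definition wedge_hom1 ::
  "('k::field \<Rightarrow> 'l::ab_group_add \<Rightarrow> 'l) \<Rightarrow> ('k \<Rightarrow> 'v::ab_group_add \<Rightarrow> 'v) \<Rightarrow> nat
    \<Rightarrow> (('l \<times> 'l) list \<Rightarrow> 'l \<Rightarrow> 'v) set" where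
  "wedge_hom1 sL sV n = {g.
     (\<forall>z. (\<lambda>Ks. g Ks z) \<in> wedge_hom sL sV n) \<and>
     (\<forall>Ks. Vector_Spaces.linear sL sV (g Ks))}"

type_synonym ('l, 'v) cochain =
  "(('l \<times> 'l) list \<Rightarrow> 'v) \<times> (('l \<times> 'l) list \<Rightarrow> 'l \<Rightarrow> 'v)"

text \<open>
  Degrees start at \<open>1\<close>; a cochain of degree \<open>n\<close> has \<open>n - 1\<close> pairs as arguments. A cochain of
  degree \<open>1\<close>, that is, a linear map \<open>f\<close> from \<open>L\<close> to \<open>V\<close>, is encoded as the pair \<open>(0, g)\<close> with
  \<open>g [] = f\<close>. With this encoding the general formulas below specialise to the ones for degree \<open>1\<close>;
  see \<open>LY_delta_1\<close> and \<open>Phi_1\<close>.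
\<close>

definition C_LY ::
  "('k::field \<Rightarrow> 'l::ab_group_add \<Rightarrow> 'l) \<Rightarrow> ('k \<Rightarrow> 'v::ab_group_add \<Rightarrow> 'v) \<Rightarrow> nat
    \<Rightarrow> ('l, 'v) cochain set" where
  "C_LY sL sV n = {(f, g). f \<in> wedge_hom sL sV (n - 1) \<and> g \<in> wedge_hom1 sL sV (n - 1) \<and>
                           (n = 1 \<longrightarrow> f = 0)}"

definition omit :: "nat \<Rightarrow> 'a list \<Rightarrow> 'a list" where
  "omit k Ks = take k Ks @ drop (Suc k) Ks"

text \<open>
  \<open>act_omit tri F k l Ks\<close> is the value of \<open>F\<close> at the arguments \<open>Ks\<close> with the \<open>k\<close>-th one omitted and
  the \<open>l\<close>-th one replaced by the sum of \<open>{x\<^sub>k, y\<^sub>k, x\<^sub>l} \<and> y\<^sub>l\<close> and \<open>x\<^sub>l \<and> {x\<^sub>k, y\<^sub>k, y\<^sub>l}\<close>, expanded by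
  linearity of \<open>F\<close> in the \<open>l\<close>-th argument.
\<close>

definition act_omit ::
  "('l \<Rightarrow> 'l \<Rightarrow> 'l \<Rightarrow> 'l) \<Rightarrow> (('l \<times> 'l) list \<Rightarrow> 'v::ab_group_add) \<Rightarrow> nat \<Rightarrow> nat
    \<Rightarrow> ('l \<times> 'l) list \<Rightarrow> 'v" where
  "act_omit tri F k l Ks =
     (case (Ks ! k, Ks ! l) of ((xk, yk), (xl, yl)) \<Rightarrow>
        F (omit k (Ks[l := (tri xk yk xl, yl)])) + F (omit k (Ks[l := (xl, tri xk yk yl)])))"

text \<open>
  \<open>delta_I n\<close> and \<open>delta_II n\<close> are the two components of the coboundary of a cochain of degree
  \<open>n + 1\<close>. Lists are indexed from \<open>0\<close>, so \<open>Ks ! n\<close> is the last of the \<open>n + 1\<close> pairs, and the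
  usual signs \<open>(-1)^(k+1)\<close> and \<open>(-1)^k\<close>, for \<open>k\<close> counted from \<open>1\<close>, become \<open>(-1)^k\<close> and
  \<open>(-1)^(k+1)\<close>.
\<close>

definition delta_I ::
  "('k::field \<Rightarrow> 'v::ab_group_add \<Rightarrow> 'v) \<Rightarrow> ('l \<Rightarrow> 'l \<Rightarrow> 'l) \<Rightarrow> ('l \<Rightarrow> 'l \<Rightarrow> 'l \<Rightarrow> 'l)
    \<Rightarrow> ('l \<Rightarrow> 'v \<Rightarrow> 'v) \<Rightarrow> ('l \<Rightarrow> 'l \<Rightarrow> 'v \<Rightarrow> 'v)
    \<Rightarrow> nat \<Rightarrow> ('l, 'v) cochain \<Rightarrow> ('l \<times> 'l) list \<Rightarrow> 'v" where
  "delta_I sV br tri rho D n c Ks =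
     (if length Ks \<noteq> n + 1 then 0 else
      case c of (f, g) \<Rightarrow> case Ks ! n of (x, y) \<Rightarrow>
        sV ((-1) ^ n) (rho x (g (take n Ks) y) - rho y (g (take n Ks) x) - g (take n Ks) (br x y))
        + (\<Sum>k<n. sV ((-1) ^ k) (D (fst (Ks ! k)) (snd (Ks ! k)) (f (omit k Ks))))
        + (\<Sum>l<n + 1. \<Sum>k<l. sV ((-1) ^ (k + 1)) (act_omit tri f k l Ks)))"

definition delta_II ::
  "('k::field \<Rightarrow> 'v::ab_group_add \<Rightarrow> 'v) \<Rightarrow> ('l \<Rightarrow> 'l \<Rightarrow> 'l \<Rightarrow> 'l)
    \<Rightarrow> ('l \<Rightarrow> 'l \<Rightarrow> 'v \<Rightarrow> 'v) \<Rightarrow> ('l \<Rightarrow> 'l \<Rightarrow> 'v \<Rightarrow> 'v)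
    \<Rightarrow> nat \<Rightarrow> ('l, 'v) cochain \<Rightarrow> ('l \<times> 'l) list \<Rightarrow> 'l \<Rightarrow> 'v" where
  "delta_II sV tri theta D n c Ks z =
     (if length Ks \<noteq> n + 1 then 0 else
      case c of (f, g) \<Rightarrow> case Ks ! n of (x, y) \<Rightarrow>
        sV ((-1) ^ n) (theta y z (g (take n Ks) x) - theta x z (g (take n Ks) y))
        + (\<Sum>k<n + 1. sV ((-1) ^ k) (D (fst (Ks ! k)) (snd (Ks ! k)) (g (omit k Ks) z)))
        + (\<Sum>l<n + 1. \<Sum>k<l. sV ((-1) ^ (k + 1)) (act_omit tri (\<lambda>Ks. g Ks z) k l Ks))
        + (\<Sum>k<n + 1. sV ((-1) ^ (k + 1)) (g (omit k Ks) (tri (fst (Ks ! k)) (snd (Ks ! k)) z))))"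

definition LY_delta ::
  "('k::field \<Rightarrow> 'v::ab_group_add \<Rightarrow> 'v) \<Rightarrow> ('l \<Rightarrow> 'l \<Rightarrow> 'l) \<Rightarrow> ('l \<Rightarrow> 'l \<Rightarrow> 'l \<Rightarrow> 'l)
    \<Rightarrow> ('l \<Rightarrow> 'v \<Rightarrow> 'v) \<Rightarrow> ('l \<Rightarrow> 'l \<Rightarrow> 'v \<Rightarrow> 'v) \<Rightarrow> ('l \<Rightarrow> 'l \<Rightarrow> 'v \<Rightarrow> 'v)
    \<Rightarrow> nat \<Rightarrow> ('l, 'v) cochain \<Rightarrow> ('l, 'v) cochain" where
  "LY_delta sV br tri rho theta D n c =
     (delta_I sV br tri rho D (n - 1) c, delta_II sV tri theta D (n - 1) c)"

lemma (in ly_representation) LY_delta_1: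
  assumes "(0, g) \<in> C_LY sL sV 1"
  shows "fst (LY_delta sV br tri rho theta D 1 (0, g)) [(x, y)] =
           rho x (g [] y) - rho y (g [] x) - g [] (br x y)"
    and "snd (LY_delta sV br tri rho theta D 1 (0, g)) [(x, y)] z =
           D x y (g [] z) + theta y z (g [] x) - theta x z (g [] y) - g [] (tri x y z)"
  by (simp_all add: LY_delta_def delta_I_def delta_II_def omit_def)


section \<open>The complex of the operator\<close>

definition br_R :: "('l \<Rightarrow> 'l \<Rightarrow> 'l::ab_group_add) \<Rightarrow> ('l \<Rightarrow> 'l) \<Rightarrow> 'l \<Rightarrow> 'l \<Rightarrow> 'l" where
  "br_R br R x y = br (R x) y + br x (R y)"

definition tri_R ::
  "('l \<Rightarrow> 'l \<Rightarrow> 'l \<Rightarrow> 'l::ab_group_add) \<Rightarrow> ('l \<Rightarrow> 'l) \<Rightarrow> 'l \<Rightarrow> 'l \<Rightarrow> 'l \<Rightarrow> 'l" where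
  "tri_R tri R x y z = tri x (R y) (R z) + tri (R x) y (R z) + tri (R x) (R y) z + tri x y z"

definition rho_R ::
  "('l \<Rightarrow> 'v \<Rightarrow> 'v::ab_group_add) \<Rightarrow> ('l \<Rightarrow> 'l) \<Rightarrow> ('v \<Rightarrow> 'v) \<Rightarrow> 'l \<Rightarrow> 'v \<Rightarrow> 'v" where
  "rho_R rho R RV x u = rho (R x) u - RV (rho x u)"

text \<open>
  Correction. The source gives the operators induced by \<open>\<theta>\<close> and \<open>D\<close> as
  \<open>T\<^sub>R(x,y)u = T(Rx,Ry)u + T(Rx,y)u + T(x,Ry)u - R\<^sub>V(T(x,y)u)\<close>, with \<open>T = \<theta>\<close> or \<open>T = D\<close>. The two
  middle terms and \<open>T(x,y)u\<close> are in the wrong places: as printed, the operator complex is not a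
  complex. Take \<open>L = V\<close> with basis \<open>e\<^sub>1, e\<^sub>2\<close>, \<open>[x,y] = 0\<close>, \<open>{x,y,z} = det(x,y) N z\<close> where
  \<open>N e\<^sub>1 = e\<^sub>2\<close> and \<open>N e\<^sub>2 = 0\<close>, the adjoint representation \<open>\<rho> = 0\<close>, \<open>\<theta>(x,y)u = {u,x,y}\<close>,
  \<open>D(x,y)u = {x,y,u}\<close>, and \<open>R = R\<^sub>V = id\<close>. For the linear map \<open>f\<close> with \<open>f e\<^sub>1 = 0\<close>, \<open>f e\<^sub>2 = e\<^sub>1\<close>, the
  printed operators give the value \<open>4 e\<^sub>2\<close>, not \<open>0\<close>, for the second component of \<open>\<partial>\<partial>f\<close> at
  \<open>(e\<^sub>1 \<and> e\<^sub>2, e\<^sub>1 \<and> e\<^sub>2, e\<^sub>1)\<close>.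

  The formula below is the one that matches \<open>\<rho>\<^sub>R\<close>, \<open>{-,-,-}\<^sub>R\<close> and the parity rule in the map \<open>\<Phi>\<close>:
  terms with an even number of arguments to which \<open>R\<close> has not been applied stand outside \<open>R\<^sub>V\<close>, the
  others inside it.
\<close>

definition theta_R ::
  "('l \<Rightarrow> 'l \<Rightarrow> 'v \<Rightarrow> 'v::ab_group_add) \<Rightarrow> ('l \<Rightarrow> 'l) \<Rightarrow> ('v \<Rightarrow> 'v) \<Rightarrow> 'l \<Rightarrow> 'l \<Rightarrow> 'v \<Rightarrow> 'v" where
  "theta_R theta R RV x y u =
     theta (R x) (R y) u + theta x y u - RV (theta (R x) y u + theta x (R y) u)"

definition D_R ::
  "('l \<Rightarrow> 'l \<Rightarrow> 'v \<Rightarrow> 'v::ab_group_add) \<Rightarrow> ('l \<Rightarrow> 'l) \<Rightarrow> ('v \<Rightarrow> 'v) \<Rightarrow> 'l \<Rightarrow> 'l \<Rightarrow> 'v \<Rightarrow> 'v" where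
  "D_R D R RV x y u = D (R x) (R y) u + D x y u - RV (D (R x) y u + D x (R y) u)"

definition MRBO_partial ::
  "('k::field \<Rightarrow> 'v::ab_group_add \<Rightarrow> 'v) \<Rightarrow> ('l \<Rightarrow> 'l \<Rightarrow> 'l::ab_group_add)
    \<Rightarrow> ('l \<Rightarrow> 'l \<Rightarrow> 'l \<Rightarrow> 'l) \<Rightarrow> ('l \<Rightarrow> 'l)
    \<Rightarrow> ('l \<Rightarrow> 'v \<Rightarrow> 'v) \<Rightarrow> ('l \<Rightarrow> 'l \<Rightarrow> 'v \<Rightarrow> 'v) \<Rightarrow> ('l \<Rightarrow> 'l \<Rightarrow> 'v \<Rightarrow> 'v) \<Rightarrow> ('v \<Rightarrow> 'v)
    \<Rightarrow> nat \<Rightarrow> ('l, 'v) cochain \<Rightarrow> ('l, 'v) cochain" where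
  "MRBO_partial sV br tri R rho theta D RV =
     LY_delta sV (br_R br R) (tri_R tri R) (rho_R rho R RV) (theta_R theta R RV) (D_R D R RV)"


section \<open>The comparison map and the complex of the algebra\<close>

text \<open>
  Argument positions are counted from \<open>0\<close>: the pair with index \<open>i\<close> occupies the positions \<open>2 * i\<close>
  and \<open>2 * i + 1\<close>, and the last argument of \<open>g\<close> has position \<open>2 * n\<close>.
\<close>

definition apply_at :: "('l \<Rightarrow> 'l) \<Rightarrow> nat set \<Rightarrow> nat \<Rightarrow> 'l \<Rightarrow> 'l" where
  "apply_at R S i x = (if i \<in> S then R x else x)"

definition apply_pairs :: "('l \<Rightarrow> 'l) \<Rightarrow> nat set \<Rightarrow> ('l \<times> 'l) list \<Rightarrow> ('l \<times> 'l) list" where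
  "apply_pairs R S Ks =
     map (\<lambda>i. (apply_at R S (2 * i) (fst (Ks ! i)), apply_at R S (2 * i + 1) (snd (Ks ! i))))
         [0..<length Ks]"

definition Phi_I ::
  "('l \<Rightarrow> 'l) \<Rightarrow> ('v \<Rightarrow> 'v::ab_group_add) \<Rightarrow> nat
    \<Rightarrow> (('l \<times> 'l) list \<Rightarrow> 'v) \<Rightarrow> ('l \<times> 'l) list \<Rightarrow> 'v" where
  "Phi_I R RV n f Ks =
     (\<Sum>S | S \<subseteq> {..<2 * n} \<and> even (card S). f (apply_pairs R S Ks))
     - RV (\<Sum>S | S \<subseteq> {..<2 * n} \<and> odd (card S). f (apply_pairs R S Ks))"

definition Phi_II ::
  "('l \<Rightarrow> 'l) \<Rightarrow> ('v \<Rightarrow> 'v::ab_group_add) \<Rightarrow> nat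
    \<Rightarrow> (('l \<times> 'l) list \<Rightarrow> 'l \<Rightarrow> 'v) \<Rightarrow> ('l \<times> 'l) list \<Rightarrow> 'l \<Rightarrow> 'v" where
  "Phi_II R RV n g Ks z =
     (\<Sum>S | S \<subseteq> {..<2 * n + 1} \<and> odd (card S).
        g (apply_pairs R S Ks) (apply_at R S (2 * n) z))
     - RV (\<Sum>S | S \<subseteq> {..<2 * n + 1} \<and> even (card S).
        g (apply_pairs R S Ks) (apply_at R S (2 * n) z))"

definition Phi ::
  "('l \<Rightarrow> 'l) \<Rightarrow> ('v \<Rightarrow> 'v::ab_group_add) \<Rightarrow> nat \<Rightarrow> ('l, 'v) cochain \<Rightarrow> ('l, 'v) cochain" where
  "Phi R RV n c = (Phi_I R RV (n - 1) (fst c), Phi_II R RV (n - 1) (snd c))"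

lemma (in modified_rb_ly_representation) Phi_1:
  assumes "(0, g) \<in> C_LY sL sV 1"
  shows "fst (Phi R RV 1 (0, g)) = 0"
    and "snd (Phi R RV 1 (0, g)) [] z = g [] (R z) - RV (g [] z)"
proof -
  interpret RV: Vector_Spaces.linear sV sV RV by (rule RV_linear)
  show "fst (Phi R RV 1 (0, g)) = 0"
    by (simp add: Phi_def Phi_I_def fun_eq_iff RV.zero)
  have "{S. S \<subseteq> {..<Suc 0} \<and> odd (card S)} = {{0}}"
    and "{S. S \<subseteq> {..<Suc 0} \<and> even (card S)} = {{}}"
    by (auto simp: lessThan_Suc subset_singleton_iff)
  then show "snd (Phi R RV 1 (0, g)) [] z = g [] (R z) - RV (g [] z)"
    by (simp add: Phi_def Phi_II_def apply_pairs_def apply_at_def)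
qed

text \<open>
  A cochain of degree \<open>n > 1\<close> of the algebra is a pair consisting of a Yamaguti cochain of degree
  \<open>n\<close> and an operator cochain of degree \<open>n - 1\<close>; in degree \<open>1\<close> the second entry is absent and set
  to \<open>0\<close>.
\<close>

definition C_MRBLY ::
  "('k::field \<Rightarrow> 'l::ab_group_add \<Rightarrow> 'l) \<Rightarrow> ('k \<Rightarrow> 'v::ab_group_add \<Rightarrow> 'v) \<Rightarrow> nat
    \<Rightarrow> (('l, 'v) cochain \<times> ('l, 'v) cochain) set" where
  "C_MRBLY sL sV n = C_LY sL sV n \<times> (if n = 1 then {0} else C_LY sL sV (n - 1))"

definition MRBLY_d ::
  "('k::field \<Rightarrow> 'v::ab_group_add \<Rightarrow> 'v) \<Rightarrow> ('l \<Rightarrow> 'l \<Rightarrow> 'l::ab_group_add)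
    \<Rightarrow> ('l \<Rightarrow> 'l \<Rightarrow> 'l \<Rightarrow> 'l) \<Rightarrow> ('l \<Rightarrow> 'l)
    \<Rightarrow> ('l \<Rightarrow> 'v \<Rightarrow> 'v) \<Rightarrow> ('l \<Rightarrow> 'l \<Rightarrow> 'v \<Rightarrow> 'v) \<Rightarrow> ('l \<Rightarrow> 'l \<Rightarrow> 'v \<Rightarrow> 'v) \<Rightarrow> ('v \<Rightarrow> 'v)
    \<Rightarrow> nat \<Rightarrow> ('l, 'v) cochain \<times> ('l, 'v) cochain \<Rightarrow> ('l, 'v) cochain \<times> ('l, 'v) cochain" where
  "MRBLY_d sV br tri R rho theta D RV n = (\<lambda>(c1, c2).
     (LY_delta sV br tri rho theta D n c1,
      if n = 1 then - Phi R RV n c1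
      else - MRBO_partial sV br tri R rho theta D RV (n - 1) c2 - Phi R RV n c1))"

end

theory Submission
  imports Defs
begin

text \<open>
  The Yamaguti complex is the cochain complex of the Leibniz algebra \<open>\<Lambda>\<^sup>2 L\<close> with coefficients in the
  bimodule \<open>V \<times> Hom(L, V)\<close>, so \<open>\<delta>\<delta> = 0\<close> follows from Cartan's formula \<open>i\<^sub>K \<delta> = L\<^sub>K - \<delta> i\<^sub>K\<close> by
  induction on the number of arguments. The maps \<open>R + 1\<close> and \<open>R - 1\<close> are homomorphisms from the
  induced algebra to \<open>L\<close>, and \<open>R\<^sub>V + 1\<close>, \<open>R\<^sub>V - 1\<close> intertwine the pullbacks of \<open>V\<close> along \<open>R - 1\<close>,
  \<open>R + 1\<close> with the induced representation. Hence the induced structure satisfies the axioms, and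
  \<open>\<partial>\<partial> = 0\<close>. Since \<open>2 \<Phi>(c) = (R\<^sub>V + 1) c(R - 1, \<dots>) - (R\<^sub>V - 1) c(R + 1, \<dots>)\<close>, functoriality of the
  Yamaguti complex shows that \<open>\<Phi>\<close> is a chain map, and \<open>d\<close> is the differential of its mapping cone.
\<close>

section \<open>Linear maps\<close>

context
  fixes s1 :: "'k::field \<Rightarrow> 'a::ab_group_add \<Rightarrow> 'a" and s2 :: "'k \<Rightarrow> 'b::ab_group_add \<Rightarrow> 'b" and f
  assumes lin: "Vector_Spaces.linear s1 s2 f"
begin

interpretation Vector_Spaces.linear s1 s2 f by (rule lin)

lemma linear_add: "f (x + y) = f x + f y" by (rule add)
lemma linear_diff: "f (x - y) = f x - f y" by (rule diff)
lemma linear_neg: "f (- x) = - f x" by (rule neg)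
lemma linear_zero: "f 0 = 0" by (rule zero)
lemma linear_scale: "f (s1 c x) = s2 c (f x)" by (rule scale)
lemma linear_sum: "f (sum g S) = (\<Sum>i\<in>S. f (g i))" by (rule sum)

end

lemmas linear_maps = linear_add linear_diff linear_neg linear_zero linear_scale

lemma (in vector_space) linearI:
  assumes "vector_space s" "\<And>x y. f (x + y) = f x + f y" "\<And>c x. f (s c x) = scale c (f x)"
  shows "Vector_Spaces.linear s scale f"
  using assms vector_space_axioms by (simp add: Vector_Spaces.linear_iff)

text \<open>Several identities below come out doubled, from adding or subtracting the versions for
  \<open>R + 1\<close> and \<open>R - 1\<close>.\<close>

lemma char_0_double_cancel:
  fixes s :: "'k::field_char_0 \<Rightarrow> 'a::ab_group_add \<Rightarrow> 'a" and u v :: 'a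
  assumes "vector_space s" "u + u = v + v"
  shows "u = v"
proof -
  interpret vector_space s by fact
  have "s 2 u = s 2 v"
    using assms(2) scale_left_distrib[of 1 1 u] scale_left_distrib[of 1 1 v] by simp
  then show ?thesis by simp
qed

section \<open>The Yamaguti complex as a Leibniz complex\<close>

text \<open>Scalar multiplication of the bimodule. Its type has all functions in place of
  \<open>Hom(L, V)\<close>, so linearity of second components is carried as a hypothesis.\<close>

definition pair_scale :: "('k \<Rightarrow> 'v \<Rightarrow> 'v) \<Rightarrow> 'k \<Rightarrow> 'v \<times> ('l \<Rightarrow> 'v) \<Rightarrow> 'v \<times> ('l \<Rightarrow> 'v)" where
  "pair_scale sV c m = (sV c (fst m), \<lambda>z. sV c (snd m z))"

context ly_representation
begin

lemmas br_maps = br_linear1[THEN linear_add] br_linear1[THEN linear_diff] br_linear1[THEN linear_neg]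
    br_linear1[THEN linear_zero] br_linear1[THEN linear_scale]
    br_linear2[THEN linear_add] br_linear2[THEN linear_diff] br_linear2[THEN linear_neg]
    br_linear2[THEN linear_zero] br_linear2[THEN linear_scale]

lemmas tri_maps =
    tri_linear1[THEN linear_add] tri_linear1[THEN linear_diff] tri_linear1[THEN linear_neg]
    tri_linear1[THEN linear_zero] tri_linear1[THEN linear_scale]
    tri_linear2[THEN linear_add] tri_linear2[THEN linear_diff] tri_linear2[THEN linear_neg]
    tri_linear2[THEN linear_zero] tri_linear2[THEN linear_scale]
    tri_linear3[THEN linear_add] tri_linear3[THEN linear_diff] tri_linear3[THEN linear_neg]
    tri_linear3[THEN linear_zero] tri_linear3[THEN linear_scale]

lemmas rho_maps =
    rho_gl[THEN linear_add] rho_gl[THEN linear_diff] rho_gl[THEN linear_neg]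
    rho_gl[THEN linear_zero] rho_gl[THEN linear_scale]
    rho_linear[THEN linear_add] rho_linear[THEN linear_diff] rho_linear[THEN linear_neg]
    rho_linear[THEN linear_zero] rho_linear[THEN linear_scale]

lemmas theta_maps =
    theta_gl[THEN linear_add] theta_gl[THEN linear_diff] theta_gl[THEN linear_neg]
    theta_gl[THEN linear_zero] theta_gl[THEN linear_scale]
    theta_linear1[THEN linear_add] theta_linear1[THEN linear_diff] theta_linear1[THEN linear_neg]
    theta_linear1[THEN linear_zero] theta_linear1[THEN linear_scale]
    theta_linear2[THEN linear_add] theta_linear2[THEN linear_diff] theta_linear2[THEN linear_neg]
    theta_linear2[THEN linear_zero] theta_linear2[THEN linear_scale]

lemmas D_maps =
    D_gl[THEN linear_add] D_gl[THEN linear_diff] D_gl[THEN linear_neg]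
    D_gl[THEN linear_zero] D_gl[THEN linear_scale]
    D_linear1[THEN linear_add] D_linear1[THEN linear_diff] D_linear1[THEN linear_neg]
    D_linear1[THEN linear_zero] D_linear1[THEN linear_scale]
    D_linear2[THEN linear_add] D_linear2[THEN linear_diff] D_linear2[THEN linear_neg]
    D_linear2[THEN linear_zero] D_linear2[THEN linear_scale]

lemmas structure_maps = br_maps tri_maps rho_maps theta_maps D_maps

section \<open>Alternation, and \<open>D\<close> as a derivation\<close>

lemma br_self: "br x x = 0"
  using char_0_double_cancel[OF vector_space_axioms, of "br x x" 0] LY1[of x x]
  by (simp add: eq_neg_iff_add_eq_0)

lemma tri_self: "tri x x y = 0"
  using char_0_double_cancel[OF vector_space_axioms, of "tri x x y" 0] LY2[of x x y]
  by (simp add: eq_neg_iff_add_eq_0)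

lemma D_self: "D x x u = 0"
  using R1[of x x u] by (simp add: br_self structure_maps)

lemma D_conv: "D x y u = theta y x u - theta x y u - rho (br x y) u
    + rho x (rho y u) - rho y (rho x u)"
  using R1[of x y u] by (simp add: algebra_simps eq_neg_iff_add_eq_0)

text \<open>By (R1), \<open>D\<close> is an expression in \<open>rho\<close>, \<open>theta\<close>
  and \<open>br\<close>, on which \<open>D a b\<close> acts as a derivation by (R4), (R6) and
  (LY5).\<close>

lemma D_tri: "D a b (D x y u) = D x y (D a b u) + D (tri a b x) y u + D x (tri a b y) u"
  by (simp add: D_conv[of x y] D_conv[of "tri a b x" y] D_conv[of x "tri a b y"]
      D_maps rho_maps R4 R6 LY5 algebra_simps)

section \<open>The Leibniz bimodule and its cochains\<close>

definition left_act :: "'l \<times> 'l \<Rightarrow> 'v \<times> ('l \<Rightarrow> 'v) \<Rightarrow> 'v \<times> ('l \<Rightarrow> 'v)" where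
  "left_act K m = (case K of (x, y) \<Rightarrow>
     (D x y (fst m), \<lambda>z. D x y (snd m z) - snd m (tri x y z)))"

text \<open>These are the degree-one formulas \<open>\<delta>\<^sup>1\<close> for the linear map
  \<open>snd m\<close>, evaluated at \<open>K\<close>.\<close>

definition right_act :: "'l \<times> 'l \<Rightarrow> 'v \<times> ('l \<Rightarrow> 'v) \<Rightarrow> 'v \<times> ('l \<Rightarrow> 'v)" where
  "right_act K m = (case K of (x, y) \<Rightarrow>
     (rho x (snd m y) - rho y (snd m x) - snd m (br x y),
      \<lambda>z. theta y z (snd m x) - theta x z (snd m y) + D x y (snd m z) - snd m (tri x y z)))"

text \<open>
  The fundamental product \<open>{x, y, x'} \<and> y' + x' \<and> {x, y, y'}\<close> makes the exterior square of \<open>L\<close> a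
  Leibniz algebra; \<open>prod1\<close> and \<open>prod2\<close> are its two summands.
\<close>

definition prod1 :: "'l \<times> 'l \<Rightarrow> 'l \<times> 'l \<Rightarrow> 'l \<times> 'l" where
  "prod1 K P = (tri (fst K) (snd K) (fst P), snd P)"

definition prod2 :: "'l \<times> 'l \<Rightarrow> 'l \<times> 'l \<Rightarrow> 'l \<times> 'l" where
  "prod2 K P = (fst P, tri (fst K) (snd K) (snd P))"

text \<open>The derivation induced by \<open>K\<close> on lists of arguments, moved onto
  \<open>F\<close>. The value type is arbitrary, to cover both the bimodule and its components in
  \<open>V\<close>.\<close>

fun slide :: "'l \<times> 'l \<Rightarrow> (('l \<times> 'l) list \<Rightarrow> 'b::ab_group_add) \<Rightarrow> ('l \<times> 'l) list \<Rightarrow> 'b" where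
  "slide K F [] = 0"
| "slide K F (P # Ks) =
     F (prod1 K P # Ks) + F (prod2 K P # Ks) + slide K (\<lambda>Ks. F (P # Ks)) Ks"

definition lie_der :: "'l \<times> 'l \<Rightarrow> (('l \<times> 'l) list \<Rightarrow> 'v \<times> ('l \<Rightarrow> 'v))
    \<Rightarrow> ('l \<times> 'l) list \<Rightarrow> 'v \<times> ('l \<Rightarrow> 'v)" where
  "lie_der K F Ks = left_act K (F Ks) - slide K F Ks"

text \<open>
  The right action enters with the sign for which \<open>right_act K m\<close> is the coboundary of the
  \<open>0\<close>-cochain \<open>m\<close>. The last equation is Cartan's formula for the contraction with \<open>K\<close>.
\<close>

fun cobd :: "(('l \<times> 'l) list \<Rightarrow> 'v \<times> ('l \<Rightarrow> 'v)) \<Rightarrow> ('l \<times> 'l) list \<Rightarrow> 'v \<times> ('l \<Rightarrow> 'v)" where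
  "cobd F [] = 0"
| "cobd F [K] = right_act K (F [])"
| "cobd F (K # P # Ks) = lie_der K F (P # Ks) - cobd (\<lambda>Ks. F (K # Ks)) (P # Ks)"

definition mlin :: "('l \<Rightarrow> 'v \<times> ('l \<Rightarrow> 'v)) \<Rightarrow> bool" where
  "mlin G \<longleftrightarrow> (\<forall>x y. G (x + y) = G x + G y) \<and> (\<forall>c x. G (sL c x) = pair_scale sV c (G x))"

definition bialt :: "('l \<times> 'l \<Rightarrow> 'v \<times> ('l \<Rightarrow> 'v)) \<Rightarrow> bool" where
  "bialt B \<longleftrightarrow> (\<forall>y. mlin (\<lambda>x. B (x, y))) \<and> (\<forall>x. mlin (\<lambda>y. B (x, y))) \<and> (\<forall>x. B (x, x) = 0)"

text \<open>No length is fixed and the entry is marked by a splitting, so the property passes to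
  \<open>F (K # _)\<close>, as inductions along Cartan's formula require.\<close>

definition multi :: "(('l \<times> 'l) list \<Rightarrow> 'v \<times> ('l \<Rightarrow> 'v)) \<Rightarrow> bool" where
  "multi F \<longleftrightarrow> (\<forall>Ks Ks'. bialt (\<lambda>P. F (Ks @ P # Ks'))) \<and>
     (\<forall>Ks. Vector_Spaces.linear sL sV (snd (F Ks)))"

lemma multi_bialt_at: "multi F \<Longrightarrow> bialt (\<lambda>P. F (Ks @ P # Ks'))"
  by (simp add: multi_def)

lemma multi_bialt: "multi F \<Longrightarrow> bialt (\<lambda>P. F (P # Ks))"
  using multi_bialt_at[of F "[]"] by simp

lemma multi_linear: "multi F \<Longrightarrow> Vector_Spaces.linear sL sV (snd (F Ks))"
  by (simp add: multi_def)

lemma multi_Cons: "multi F \<Longrightarrow> multi (\<lambda>Ks. F (K # Ks))"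
  using multi_bialt_at[of F "K # Ks" for Ks] by (simp add: multi_def multi_linear)

lemma bialt_add_left: "bialt B \<Longrightarrow> B (x + x', y) = B (x, y) + B (x', y)"
  and bialt_add_right: "bialt B \<Longrightarrow> B (x, y + y') = B (x, y) + B (x, y')"
  by (simp_all add: bialt_def mlin_def)

lemma multi_add:
  assumes "multi F"
  shows "F ((x + x', y) # Ks) = F ((x, y) # Ks) + F ((x', y) # Ks)"
    and "F ((x, y + y') # Ks) = F ((x, y) # Ks) + F ((x, y') # Ks)"
  using multi_bialt[OF assms, of Ks, THEN bialt_add_left] multi_bialt[OF assms, of Ks, THEN bialt_add_right]
  by auto

section \<open>Additivity, bimodule identities and Cartan calculus\<close>

lemma left_act_add: "left_act K (m + m') = left_act K m + left_act K m'"
  by (auto simp: left_act_def structure_maps algebra_simps split: prod.splits)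

lemma left_act_diff: "left_act K (m - m') = left_act K m - left_act K m'"
  by (auto simp: left_act_def structure_maps algebra_simps split: prod.splits)

lemma left_act_zero: "left_act K 0 = 0"
  by (auto simp: left_act_def structure_maps zero_prod_def split: prod.splits)

lemma right_act_add: "right_act K (m + m') = right_act K m + right_act K m'"
  by (auto simp: right_act_def structure_maps algebra_simps split: prod.splits)

lemma right_act_diff: "right_act K (m - m') = right_act K m - right_act K m'"
  by (auto simp: right_act_def structure_maps algebra_simps split: prod.splits)

lemma right_act_zero: "right_act K 0 = 0"
  by (auto simp: right_act_def structure_maps zero_prod_def split: prod.splits)

lemma slide_add: "slide K (\<lambda>Ks. F Ks + G Ks) Ks = slide K F Ks + slide K G Ks"
  by (induction Ks arbitrary: F G) (simp_all add: algebra_simps)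

lemma slide_diff: "slide K (\<lambda>Ks. F Ks - G Ks) Ks = slide K F Ks - slide K G Ks"
  by (induction Ks arbitrary: F G) (simp_all add: algebra_simps)

lemma slide_left_act: "slide K (\<lambda>Ks. left_act K' (F Ks)) Ks = left_act K' (slide K F Ks)"
  by (induction Ks arbitrary: F) (simp_all add: left_act_add left_act_zero)

lemma lie_der_add: "lie_der K (\<lambda>Ks. F Ks + G Ks) Ks = lie_der K F Ks + lie_der K G Ks"
  by (simp add: lie_der_def slide_add left_act_add)

lemma lie_der_diff: "lie_der K (\<lambda>Ks. F Ks - G Ks) Ks = lie_der K F Ks - lie_der K G Ks"
  by (simp add: lie_der_def slide_diff left_act_diff)

lemma cobd_add: "cobd (\<lambda>Ks. F Ks + G Ks) Ks = cobd F Ks + cobd G Ks"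
proof (induction Ks arbitrary: F G)
  case (Cons K Ks)
  then show ?case by (cases Ks) (simp_all add: right_act_add lie_der_add)
qed simp

lemma cobd_diff: "cobd (\<lambda>Ks. F Ks - G Ks) Ks = cobd F Ks - cobd G Ks"
proof (induction Ks arbitrary: F G)
  case (Cons K Ks)
  then show ?case by (cases Ks) (simp_all add: right_act_diff lie_der_diff)
qed simp

text \<open>\<open>D_tri\<close> settles the terms with two factors \<open>D\<close>, and (LY6)
  those with two factors \<open>tri\<close>.\<close>

lemma left_act_comm:
  assumes "Vector_Spaces.linear sL sV (snd m)"
  shows "left_act K (left_act K' m) - left_act K' (left_act K m) =
           left_act (prod1 K K') m + left_act (prod2 K K') m"
proof -
  obtain a b x y where [simp]: "K = (a, b)" "K' = (x, y)" by fastforce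
  show ?thesis
    by (auto simp: left_act_def prod1_def prod2_def D_tri[of a b] D_maps linear_maps[OF assms]
        LY6[of a b] fun_eq_iff prod_eq_iff algebra_simps)
qed

text \<open>The action of \<open>K\<close> is a derivation of every structure map in
  \<open>right_act\<close>, by (LY5), (LY6), (R4), (R6) and \<open>D_tri\<close>.\<close>

lemma left_right_act:
  assumes "Vector_Spaces.linear sL sV (snd m)"
  shows "left_act K (right_act K' m) =
           right_act K' (left_act K m) + right_act (prod1 K K') m + right_act (prod2 K K') m"
proof -
  obtain a b x y where [simp]: "K = (a, b)" "K' = (x, y)" by fastforce
  show ?thesis
    by (auto simp: left_act_def right_act_def prod1_def prod2_def D_tri[of a b] D_maps rho_maps
        theta_maps linear_maps[OF assms] LY5 R4 R6 LY6[of a b] fun_eq_iff prod_eq_iff algebra_simps)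
qed

text \<open>For \<open>K = (a, b)\<close> the second components of \<open>right_act K m\<close> and
  \<open>left_act K m\<close> differ by
  \<open>z \<mapsto> theta b z (snd m a) - theta a z (snd m b)\<close>. This map is killed by
  \<open>right_act K'\<close>: (R5) gives the first component and (R7) the second.\<close>

lemma right_left_act:
  assumes "Vector_Spaces.linear sL sV (snd m)"
  shows "right_act K' (left_act K m) = right_act K' (right_act K m)"
proof -
  obtain a b x y where [simp]: "K = (a, b)" "K' = (x, y)" by fastforce
  show ?thesis
    by (auto simp: left_act_def right_act_def D_maps rho_maps
        theta_maps linear_maps[OF assms] R5 R7 fun_eq_iff prod_eq_iff algebra_simps)
qed

text \<open>Substitutions into different slots commute and cancel; two into the same slot combine by
  (LY6). The sign is opposite to \<open>left_act_comm\<close> because arguments are acted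
  on.\<close>

lemma slide_comm:
  assumes "multi F"
  shows "slide K (slide K' F) Ks - slide K' (slide K F) Ks =
           - slide (prod1 K K') F Ks - slide (prod2 K K') F Ks"
  using assms
proof (induction Ks arbitrary: F)
  case (Cons P Ks)
  obtain a b x y p q where [simp]: "K = (a, b)" "K' = (x, y)" "P = (p, q)" by (metis surj_pair)
  have *: "tri a b (tri x y z) = tri x y (tri a b z) + tri (tri a b x) y z + tri x (tri a b y) z" for z
    by (simp add: LY6[of a b] algebra_simps)
  note IH = Cons.IH[OF multi_Cons[OF Cons.prems, of P]]
  then have IH': "slide K (slide K' (\<lambda>Ks. F (P # Ks))) Ks =
      slide K' (slide K (\<lambda>Ks. F (P # Ks))) Ks
      - slide (prod1 K K') (\<lambda>Ks. F (P # Ks)) Ks - slide (prod2 K K') (\<lambda>Ks. F (P # Ks)) Ks"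
    by (simp add: algebra_simps)
  show ?case
    using IH'
    by (simp add: slide_add multi_add[OF Cons.prems] prod1_def prod2_def * algebra_simps)
qed simp

text \<open>The mixed terms are symmetric in \<open>K\<close> and \<open>K'\<close>, since
  \<open>slide\<close> commutes with \<open>left_act\<close>, and cancel; the others are
  \<open>left_act_comm\<close> and \<open>slide_comm\<close>.\<close>

lemma lie_der_comm:
  assumes "multi F"
  shows "lie_der K (lie_der K' F) Ks - lie_der K' (lie_der K F) Ks =
           lie_der (prod1 K K') F Ks + lie_der (prod2 K K') F Ks"
proof -
  have *: "lie_der K (lie_der K' F) Ks = left_act K (left_act K' (F Ks)) - left_act K (slide K' F Ks)
      - left_act K' (slide K F Ks) + slide K (slide K' F) Ks" for K K'
  proof -
    have "lie_der K' F = (\<lambda>Ks. left_act K' (F Ks) - slide K' F Ks)" by (auto simp: lie_der_def)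
    then show ?thesis
      by (simp add: lie_der_def slide_diff slide_left_act left_act_diff algebra_simps)
  qed
  have "lie_der K (lie_der K' F) Ks - lie_der K' (lie_der K F) Ks =
      (left_act K (left_act K' (F Ks)) - left_act K' (left_act K (F Ks)))
      + (slide K (slide K' F) Ks - slide K' (slide K F) Ks)"
    unfolding * by (simp add: algebra_simps)
  also have "\<dots> = lie_der (prod1 K K') F Ks + lie_der (prod2 K K') F Ks"
    unfolding slide_comm[OF assms] left_act_comm[OF multi_linear[OF assms]]
    by (simp add: lie_der_def algebra_simps)
  finally show ?thesis .
qed

text \<open>Contraction with \<open>P\<close> and the Lie derivative along \<open>K\<close> commute
  up to contraction with the fundamental product of \<open>K\<close> and \<open>P\<close>.\<close>

lemma lie_der_Cons:
  "lie_der K F (P # Ks) = lie_der K (\<lambda>Ks. F (P # Ks)) Ks - F (prod1 K P # Ks) - F (prod2 K P # Ks)"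
  by (simp add: lie_der_def algebra_simps)

lemma slide_cong: "(\<And>Ls. length Ls = length Ks \<Longrightarrow> F Ls = G Ls) \<Longrightarrow> slide K F Ks = slide K G Ks"
proof (induction Ks arbitrary: F G)
  case (Cons P Ks)
  have "slide K (\<lambda>Ks. F (P # Ks)) Ks = slide K (\<lambda>Ks. G (P # Ks)) Ks"
    by (rule Cons.IH) (simp add: Cons.prems)
  then show ?case by (simp add: Cons.prems)
qed simp

lemma lie_der_cong: "(\<And>Ls. length Ls = length Ks \<Longrightarrow> F Ls = G Ls) \<Longrightarrow> lie_der K F Ks = lie_der K G Ks"
  using slide_cong[of Ks F G K] by (simp add: lie_der_def)

lemma cobd_Cons:
  "Ks \<noteq> [] \<Longrightarrow> cobd F (K # Ks) = lie_der K F Ks - cobd (\<lambda>Ks. F (K # Ks)) Ks"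
  by (cases Ks) simp_all

text \<open>A single argument is \<open>left_right_act\<close>. Otherwise Cartan's formula at
  \<open>P\<close> reduces to the contracted function, and what remains is the commutator of
  \<open>lie_der K\<close> and \<open>lie_der P\<close>.\<close>

lemma cobd_lie_der:
  assumes "multi F" "Ks \<noteq> []"
  shows "cobd (lie_der K F) Ks = lie_der K (cobd F) Ks"
  using assms
proof (induction Ks arbitrary: F)
  case (Cons P Ks)
  show ?case
  proof (cases "Ks = []")
    case True
    then show ?thesis
      by (simp add: lie_der_def left_right_act[OF multi_linear[OF Cons.prems(1)]])
  next
    case False
    have 1: "cobd (lie_der K F) (P # Ks) =
        lie_der P (lie_der K F) Ks - cobd (lie_der K (\<lambda>Ks. F (P # Ks))) Ks
        + cobd (\<lambda>Ks. F (prod1 K P # Ks)) Ks + cobd (\<lambda>Ks. F (prod2 K P # Ks)) Ks"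
      using False by (simp add: cobd_Cons lie_der_Cons cobd_diff)
    have "lie_der K (\<lambda>Ks. cobd F (P # Ks)) Ks =
        lie_der K (\<lambda>Ks. lie_der P F Ks - cobd (\<lambda>Ks. F (P # Ks)) Ks) Ks"
      using False by (intro lie_der_cong cobd_Cons) auto
    then have 2: "lie_der K (cobd F) (P # Ks) =
        lie_der K (lie_der P F) Ks - lie_der K (cobd (\<lambda>Ks. F (P # Ks))) Ks
        - lie_der (prod1 K P) F Ks + cobd (\<lambda>Ks. F (prod1 K P # Ks)) Ks
        - lie_der (prod2 K P) F Ks + cobd (\<lambda>Ks. F (prod2 K P # Ks)) Ks"
      using False by (simp add: lie_der_Cons cobd_Cons lie_der_diff algebra_simps)
    have 3: "cobd (lie_der K (\<lambda>Ks. F (P # Ks))) Ks = lie_der K (cobd (\<lambda>Ks. F (P # Ks))) Ks"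
      using Cons False by (simp add: multi_Cons)
    show ?thesis
      unfolding 1 2 3 using lie_der_comm[OF Cons.prems(1), of K P Ks] by (simp add: algebra_simps)
  qed
qed simp

text \<open>Cartan's formula \<open>cobd_Cons\<close> fails for the empty list and is thus no
  equation of functions; this rule restricts the comparison to lists one shorter.\<close>

lemma cobd_cong: "(\<And>Ls. Suc (length Ls) = length Ks \<Longrightarrow> F Ls = G Ls) \<Longrightarrow> cobd F Ks = cobd G Ks"
proof (induction Ks arbitrary: F G)
  case (Cons K Ks)
  show ?case
  proof (cases "Ks = []")
    case False
    have "lie_der K F Ks = lie_der K G Ks"
      by (rule lie_der_cong) (simp add: Cons.prems)
    moreover have "cobd (\<lambda>Ks. F (K # Ks)) Ks = cobd (\<lambda>Ks. G (K # Ks)) Ks"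
      by (rule Cons.IH) (simp add: Cons.prems)
    ultimately show ?thesis using False by (simp add: cobd_Cons)
  qed (use Cons.prems in simp)
qed simp

text \<open>\<open>i\<^sub>K \<delta>\<delta> = L\<^sub>K \<delta> - \<delta> L\<^sub>K +
  \<delta>\<delta> i\<^sub>K\<close>: the first two terms cancel by \<open>cobd_lie_der\<close>, and
  the last vanishes by induction.\<close>

lemma cobd_cobd:
  assumes "multi F" "length Ks \<ge> 2"
  shows "cobd (cobd F) Ks = 0"
  using assms
proof (induction Ks arbitrary: F)
  case (Cons K Ks)
  show ?case
  proof (cases Ks)
    case (Cons P Ls)
    show ?thesis
    proof (cases "Ls = []")
      case True
      \<comment> \<open>Two arguments: with \<open>m = F []\<close>, \<open>left_right_act\<close>
        leaves \<open>right_act P (left_act K m) - right_act P (right_act K m)\<close>, which is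
        \<open>0\<close> by \<open>right_left_act\<close>.\<close>
      then show ?thesis
        using Cons by (simp add: lie_der_def left_right_act right_left_act
            multi_linear[OF \<open>multi F\<close>])
    next
      case False
      have "cobd (\<lambda>Ks. cobd F (K # Ks)) Ks = cobd (\<lambda>Ks. lie_der K F Ks - cobd (\<lambda>Ks. F (K # Ks)) Ks) Ks"
        using False Cons by (intro cobd_cong cobd_Cons) auto
      also have "\<dots> = lie_der K (cobd F) Ks - 0"
        using Cons.IH[OF multi_Cons[OF \<open>multi F\<close>, of K]] False Cons
          cobd_lie_der[OF \<open>multi F\<close>, of Ks K]
        by (cases Ls) (simp_all only: cobd_diff list.size, auto)
      finally show ?thesis using Cons by (simp add: cobd_Cons)
    qed
  qed (use Cons.prems in simp)
qed simp

section \<open>Multilinearity of the coboundary\<close>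

lemma mlin_iff: "mlin G \<longleftrightarrow>
    Vector_Spaces.linear sL sV (\<lambda>x. fst (G x)) \<and> (\<forall>z. Vector_Spaces.linear sL sV (\<lambda>x. snd (G x) z))"
  by (auto simp: mlin_def Vector_Spaces.linear_iff pair_scale_def vector_space_axioms
      V.vector_space_axioms fun_eq_iff prod_eq_iff)

lemma mlin_zero: "mlin (\<lambda>x. 0)"
  and mlin_plus: "mlin G \<Longrightarrow> mlin H \<Longrightarrow> mlin (\<lambda>x. G x + H x)"
  and mlin_minus: "mlin G \<Longrightarrow> mlin H \<Longrightarrow> mlin (\<lambda>x. G x - H x)"
  and mlin_comp: "mlin G \<Longrightarrow> Vector_Spaces.linear sL sL h \<Longrightarrow> mlin (\<lambda>x. G (h x))"
  by (auto simp: mlin_def linear_maps pair_scale_def prod_eq_iff fun_eq_iff algebra_simps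
      V.scale_right_distrib V.scale_right_diff_distrib)

lemma left_act_scale: "left_act K (pair_scale sV c m) = pair_scale sV c (left_act K m)"
  by (auto simp: left_act_def pair_scale_def structure_maps V.scale_right_diff_distrib split: prod.splits)

lemma right_act_scale: "right_act K (pair_scale sV c m) = pair_scale sV c (right_act K m)"
  by (auto simp: right_act_def pair_scale_def structure_maps V.scale_right_diff_distrib
      V.scale_right_distrib split: prod.splits)

lemma mlin_left_act: "mlin G \<Longrightarrow> mlin (\<lambda>x. left_act K (G x))"
  by (simp add: mlin_def left_act_add left_act_scale)

lemma bialt_zero: "bialt (\<lambda>P. 0)"
  and bialt_plus: "bialt B \<Longrightarrow> bialt B' \<Longrightarrow> bialt (\<lambda>P. B P + B' P)"
  and bialt_minus: "bialt B \<Longrightarrow> bialt B' \<Longrightarrow> bialt (\<lambda>P. B P - B' P)"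
  and bialt_left_act: "bialt B \<Longrightarrow> bialt (\<lambda>P. left_act K (B P))"
  by (auto simp: bialt_def mlin_zero mlin_plus mlin_minus mlin_left_act left_act_zero)

lemma bialt_skew: "bialt B \<Longrightarrow> B (x, y) + B (y, x) = 0"
  using bialt_add_left[of B x y "x + y"]
  by (simp add: bialt_add_right bialt_def[of B])

lemma bialt_comp:
  assumes "bialt B" "Vector_Spaces.linear sL sL h"
  shows "mlin (\<lambda>x. B (h x, y))" "mlin (\<lambda>x. B (y, h x))"
  using assms mlin_comp[of "\<lambda>x. B (x, y)" h] mlin_comp[of "\<lambda>x. B (y, x)" h]
  by (simp_all add: bialt_def)

lemma bialt_0: "bialt B \<Longrightarrow> B (0, y) = 0" "bialt B \<Longrightarrow> B (y, 0) = 0"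
  using bialt_add_left[of B 0 0 y] bialt_add_right[of B y 0 0] by simp_all

text \<open>On \<open>(x, x)\<close> the two summands cancel each other, by skew symmetry of
  \<open>B\<close>; in \<open>bialt_prod'\<close> each vanishes by \<open>tri_self\<close>.\<close>

lemma bialt_prod:
  assumes "bialt B"
  shows "bialt (\<lambda>P. B (prod1 K P) + B (prod2 K P))"
proof -
  have "Vector_Spaces.linear sL sL (\<lambda>x. x)"
    by (simp add: Vector_Spaces.linear_iff vector_space_axioms)
  then show ?thesis
    unfolding bialt_def prod1_def prod2_def fst_conv snd_conv
    by (intro conjI allI mlin_plus bialt_comp[OF assms] tri_linear3 bialt_skew[OF assms])
qed

lemma bialt_prod':
  assumes "bialt B"
  shows "bialt (\<lambda>K. B (prod1 K P) + B (prod2 K P))"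
proof -
  have "B (tri x x y, z) + B (w, tri x x v) = 0" for x y z v w
    by (simp add: tri_self bialt_0[OF assms])
  then show ?thesis
    unfolding bialt_def prod1_def prod2_def fst_conv snd_conv
    by (intro conjI allI mlin_plus bialt_comp[OF assms] tri_linear1 tri_linear2)
qed

lemma slide_zero: "slide K (\<lambda>Ks. 0) Ks = 0"
  by (induction Ks) simp_all

lemma pair_scale_add: "pair_scale sV c (m + m') = pair_scale sV c m + pair_scale sV c m'"
  and pair_scale_diff: "pair_scale sV c (m - m') = pair_scale sV c m - pair_scale sV c m'"
  and pair_scale_zero: "pair_scale sV c 0 = 0"
  by (simp_all add: pair_scale_def prod_eq_iff fun_eq_iff V.scale_right_distrib
      V.scale_right_diff_distrib)

lemma slide_scale: "slide K (\<lambda>Ks. pair_scale sV c (F Ks)) Ks = pair_scale sV c (slide K F Ks)"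
  by (induction Ks arbitrary: F) (simp_all add: pair_scale_add pair_scale_zero)

lemma lie_der_scale: "lie_der K (\<lambda>Ks. pair_scale sV c (F Ks)) Ks = pair_scale sV c (lie_der K F Ks)"
  by (simp add: lie_der_def slide_scale left_act_scale pair_scale_diff)

lemma lie_der_zero: "lie_der K (\<lambda>Ks. 0) Ks = 0"
  by (simp add: lie_der_def slide_zero left_act_zero)

lemma cobd_scale: "cobd (\<lambda>Ks. pair_scale sV c (F Ks)) Ks = pair_scale sV c (cobd F Ks)"
proof (induction Ks arbitrary: F)
  case (Cons K Ks)
  then show ?case
    by (cases Ks) (simp_all add: right_act_scale lie_der_scale pair_scale_diff)
qed (simp add: pair_scale_zero)

lemma cobd_zero: "cobd (\<lambda>Ks. 0) Ks = 0"
proof (induction Ks)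
  case (Cons K Ks)
  then show ?case
    by (cases Ks) (simp_all add: right_act_zero lie_der_zero)
qed simp

text \<open>\<open>P\<close> is a parameter here, as after a contraction;
  \<open>bialt_slide'\<close> treats the acting pair and \<open>bialt_slide_at\<close> an entry of
  the list.\<close>

lemma bialt_slide:
  assumes "\<And>Ks. bialt (\<lambda>P. G P Ks)"
  shows "bialt (\<lambda>P. slide K (G P) Ks)"
proof -
  have "G (x, x) = (\<lambda>Ks. 0)"
    and "G (x + x', y) = (\<lambda>Ks. G (x, y) Ks + G (x', y) Ks)"
    and "G (sL c x, y) = (\<lambda>Ks. pair_scale sV c (G (x, y) Ks))"
    and "G (x, y + y') = (\<lambda>Ks. G (x, y) Ks + G (x, y') Ks)"
    and "G (x, sL c y) = (\<lambda>Ks. pair_scale sV c (G (x, y) Ks))" for x x' y y' c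
    using assms by (auto simp: bialt_def mlin_def)
  then show ?thesis
    by (simp add: bialt_def mlin_def slide_add slide_scale slide_zero)
qed

lemma bialt_cobd:
  assumes "\<And>Ks. bialt (\<lambda>P. G P Ks)"
  shows "bialt (\<lambda>P. cobd (G P) Ks)"
proof -
  have "G (x, x) = (\<lambda>Ks. 0)"
    and "G (x + x', y) = (\<lambda>Ks. G (x, y) Ks + G (x', y) Ks)"
    and "G (sL c x, y) = (\<lambda>Ks. pair_scale sV c (G (x, y) Ks))"
    and "G (x, y + y') = (\<lambda>Ks. G (x, y) Ks + G (x, y') Ks)"
    and "G (x, sL c y) = (\<lambda>Ks. pair_scale sV c (G (x, y) Ks))" for x x' y y' c
    using assms by (auto simp: bialt_def mlin_def)
  then show ?thesis
    by (simp add: bialt_def mlin_def cobd_add cobd_scale cobd_zero)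
qed

lemma bialt_left_act':
  assumes "Vector_Spaces.linear sL sV (snd m)"
  shows "bialt (\<lambda>K. left_act K m)"
  by (auto simp: bialt_def mlin_def left_act_def pair_scale_def linear_maps[OF assms] structure_maps
      D_self tri_self prod_eq_iff fun_eq_iff V.scale_right_diff_distrib)

lemma bialt_right_act':
  assumes "Vector_Spaces.linear sL sV (snd m)"
  shows "bialt (\<lambda>K. right_act K m)"
  by (auto simp: bialt_def mlin_def right_act_def pair_scale_def linear_maps[OF assms] structure_maps
      D_self tri_self br_self prod_eq_iff fun_eq_iff V.scale_right_diff_distrib V.scale_right_distrib)

lemma bialt_slide':
  assumes "multi F"
  shows "bialt (\<lambda>K. slide K F Ks)"
  using assms
proof (induction Ks arbitrary: F)
  case (Cons P Ks)
  then show ?case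
    by (auto intro!: bialt_plus[OF bialt_prod'[where B="\<lambda>P. F (P # Ks)"]] multi_bialt multi_Cons)
qed (simp add: bialt_zero)

lemma linear_left_act:
  assumes "Vector_Spaces.linear sL sV (snd m)"
  shows "Vector_Spaces.linear sL sV (snd (left_act K m))"
  by (intro V.linearI vector_space_axioms)
    (auto simp: left_act_def linear_maps[OF assms] structure_maps V.scale_right_diff_distrib split: prod.splits)

lemma linear_right_act:
  assumes "Vector_Spaces.linear sL sV (snd m)"
  shows "Vector_Spaces.linear sL sV (snd (right_act K m))"
  by (intro V.linearI vector_space_axioms)
    (auto simp: right_act_def linear_maps[OF assms] structure_maps V.scale_right_diff_distrib
      V.scale_right_distrib split: prod.splits)

lemma linear_snd_plus:
  "Vector_Spaces.linear sL sV (snd m) \<Longrightarrow> Vector_Spaces.linear sL sV (snd m') \<Longrightarrow>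
   Vector_Spaces.linear sL sV (snd (m + m'))"
  "Vector_Spaces.linear sL sV (snd m) \<Longrightarrow> Vector_Spaces.linear sL sV (snd m') \<Longrightarrow>
   Vector_Spaces.linear sL sV (snd (m - m'))"
  "Vector_Spaces.linear sL sV (snd 0)"
  by (auto simp: Vector_Spaces.linear_iff V.scale_right_distrib V.scale_right_diff_distrib
     vector_space_axioms V.vector_space_axioms)

lemma linear_slide:
  assumes "\<And>Ks. Vector_Spaces.linear sL sV (snd (F Ks))"
  shows "Vector_Spaces.linear sL sV (snd (slide K F Ks))"
  using assms
proof (induction Ks arbitrary: F)
  case (Cons P Ks)
  show ?case unfolding slide.simps by (intro linear_snd_plus Cons)
qed (simp only: slide.simps linear_snd_plus)

lemma bialt_slide_at:
  assumes "multi F"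
  shows "bialt (\<lambda>P. slide K F (Ks @ P # Ks'))"
  using assms
proof (induction Ks arbitrary: F)
  case Nil
  then show ?case
    by (auto intro!: bialt_plus[OF bialt_prod[where B="\<lambda>P. F (P # Ks')"]] multi_bialt bialt_slide)
next
  case (Cons Q Ks)
  have "bialt (\<lambda>P. F (Q' # Ks @ P # Ks'))" for Q'
    using multi_Cons[OF Cons.prems] by (simp add: multi_def)
  then show ?case
    unfolding append_Cons slide.simps by (intro bialt_plus Cons.IH multi_Cons[OF Cons.prems])
qed

lemma multi_lie_der: "multi F \<Longrightarrow> multi (lie_der K F)"
  unfolding multi_def[of "lie_der K F"] lie_der_def
  by (intro conjI allI bialt_minus bialt_slide_at bialt_left_act linear_snd_plus(2) linear_slide
      linear_left_act multi_linear multi_bialt_at)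

text \<open>Induction on the position: the first entry is the acting pair of Cartan's formula, and a
  later one is an entry of the Lie derivative and of the contracted coboundary.\<close>

lemma bialt_cobd_at:
  assumes "multi F"
  shows "bialt (\<lambda>P. cobd F (Ks @ P # Ks'))"
  using assms
proof (induction Ks arbitrary: F)
  case Nil
  show ?case
  proof (cases "Ks' = []")
    case True
    then show ?thesis using Nil by (simp add: bialt_right_act' multi_linear)
  next
    case False
    then show ?thesis
      using Nil by (auto simp: cobd_Cons lie_der_def intro!: bialt_minus bialt_left_act'
         bialt_slide' bialt_cobd multi_linear multi_bialt)
  qed
next
  case (Cons Q Ks)
  have "bialt (\<lambda>P. lie_der Q F (Ks @ P # Ks'))"
    using multi_lie_der[OF Cons.prems] by (simp add: multi_def)
  then show ?case
    using Cons by (auto simp: cobd_Cons intro!: bialt_minus multi_Cons)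
qed

lemma multi_cobd:
  assumes "multi F"
  shows "multi (cobd F)"
proof -
  have "Vector_Spaces.linear sL sV (snd (cobd F Ks))" for Ks
    using assms
  proof (induction Ks arbitrary: F)
    case (Cons K Ks)
    show ?case
    proof (cases "Ks = []")
      case True
      then show ?thesis using Cons.prems by (simp add: linear_right_act multi_linear)
    next
      case False
      then show ?thesis
        unfolding cobd_Cons[OF False]
        using linear_snd_plus(2)[OF multi_linear[OF multi_lie_der[OF Cons.prems]]
            Cons.IH[OF multi_Cons[OF Cons.prems]]]
        by blast
    qed
  qed (simp only: cobd.simps linear_snd_plus)
  then show ?thesis using bialt_cobd_at[OF assms] by (simp add: multi_def)
qed

section \<open>The explicit formulas and the recursive coboundary\<close>

definition pack :: "('l, 'v) cochain \<Rightarrow> ('l \<times> 'l) list \<Rightarrow> 'v \<times> ('l \<Rightarrow> 'v)" where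
  "pack c Ks = (fst c Ks, snd c Ks)"

text \<open>Splittings replace list updates to match \<open>multi\<close>; they may range over lists
  of every length since \<open>f\<close> vanishes off length \<open>n\<close>.\<close>

lemma wedge_hom_iff:
  "f \<in> wedge_hom sL sV n \<longleftrightarrow>
     (\<forall>Ks. length Ks \<noteq> n \<longrightarrow> f Ks = 0) \<and>
     (\<forall>Ks Ks'. (\<forall>y. Vector_Spaces.linear sL sV (\<lambda>x. f (Ks @ (x, y) # Ks'))) \<and>
        (\<forall>x. Vector_Spaces.linear sL sV (\<lambda>y. f (Ks @ (x, y) # Ks'))) \<and>
        (\<forall>x. f (Ks @ (x, x) # Ks') = 0))" (is "_ \<longleftrightarrow> ?off \<and> (\<forall>Ks Ks'. ?P Ks Ks')")
proof
  assume f: "f \<in> wedge_hom sL sV n"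
  have "?P Ks Ks'" for Ks Ks'
  \<comment> \<open>The entry \<open>(0, 0)\<close> is a placeholder that the list update in
    \<open>wedge_hom\<close> overwrites.\<close>
  proof (cases "length (Ks @ (0, 0) # Ks') = n")
    case True
    then show ?thesis
      using f unfolding wedge_hom_def
      by (auto dest!: spec[of _ "Ks @ (0, 0) # Ks'"] spec[of _ "length Ks"])
  next
    case False
    then have "f (Ks @ P # Ks') = 0" for P
      using f by (auto simp: wedge_hom_def)
    then show ?thesis
      by (auto simp: Vector_Spaces.linear_iff vector_space_axioms V.vector_space_axioms)
  qed
  then show "?off \<and> (\<forall>Ks Ks'. ?P Ks Ks')"
    using f by (auto simp: wedge_hom_def)
next
  assume "?off \<and> (\<forall>Ks Ks'. ?P Ks Ks')"
  then show "f \<in> wedge_hom sL sV n"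
    unfolding wedge_hom_def by (auto simp: upd_conv_take_nth_drop)
qed

lemma C_LY_iff:
  "c \<in> C_LY sL sV n \<longleftrightarrow>
     multi (pack c) \<and> (\<forall>Ks. length Ks \<noteq> n - 1 \<longrightarrow> pack c Ks = 0) \<and> (n = 1 \<longrightarrow> fst c = 0)"
  by (cases c) (auto simp: C_LY_def wedge_hom1_def wedge_hom_iff multi_def bialt_def mlin_iff pack_def
      fun_eq_iff prod_eq_iff)

lemma slide_eq_sum: "slide K F Ks =
    (\<Sum>l<length Ks. F (Ks[l := prod1 K (Ks ! l)]) + F (Ks[l := prod2 K (Ks ! l)]))"
  by (induction Ks arbitrary: F) (simp_all add: sum.lessThan_Suc_shift del: sum.lessThan_Suc)

lemma omit_Cons: "omit 0 (K # Ks) = Ks" "omit (Suc k) (K # Ks) = K # omit k Ks"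
  by (simp_all add: omit_def)

lemma act_omit_Cons:
  "act_omit tri F 0 (Suc l) (K # Ks) =
     F (Ks[l := prod1 K (Ks ! l)]) + F (Ks[l := prod2 K (Ks ! l)])"
  "act_omit tri F (Suc k) (Suc l) (K # Ks) = act_omit tri (\<lambda>Ks. F (K # Ks)) k l Ks"
  by (auto simp: act_omit_def omit_Cons prod1_def prod2_def split: prod.splits)

lemma alt_sum_Cons:
  "(\<Sum>k<Suc m. sV ((-1) ^ k) (h k)) = h 0 - (\<Sum>k<m. sV ((-1) ^ k) (h (Suc k)))"
  "(\<Sum>k<Suc m. sV ((-1) ^ (k + 1)) (h k)) = - h 0 - (\<Sum>k<m. sV ((-1) ^ (k + 1)) (h (Suc k)))"
  by (simp_all add: sum.lessThan_Suc_shift sum_negf del: sum.lessThan_Suc)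

text \<open>The terms with \<open>k = 0\<close> let the first argument act on the others, which is
  \<open>slide\<close>; in the rest, the shift of \<open>k\<close> flips the signs.\<close>

lemma act_sum_Cons:
  assumes "length Ks = m"
  shows "(\<Sum>l<Suc m. \<Sum>k<l. sV ((-1) ^ (k + 1)) (act_omit tri F k l (K # Ks))) =
    - slide K F Ks
    - (\<Sum>l<m. \<Sum>k<l. sV ((-1) ^ (k + 1)) (act_omit tri (\<lambda>Ks. F (K # Ks)) k l Ks))"
  unfolding sum.lessThan_Suc_shift[of _ m] alt_sum_Cons act_omit_Cons slide_eq_sum assms
  by (simp add: sum.distrib sum_subtractf sum_negf algebra_simps)

lemma delta_I_Cons:
  assumes "length Ks = n + 1"
  shows "delta_I sV br tri rho D (Suc n) (f, g) (K # Ks) =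
     D (fst K) (snd K) (f Ks) - slide K f Ks
     - delta_I sV br tri rho D n (\<lambda>Ks. f (K # Ks), \<lambda>Ks. g (K # Ks)) Ks"
  using assms act_sum_Cons[OF assms, of f K]
  unfolding delta_I_def
  by (simp add: alt_sum_Cons omit_Cons algebra_simps split: prod.splits del: sum.lessThan_Suc)

lemma delta_II_Cons:
  assumes "length Ks = n + 1"
  shows "delta_II sV tri theta D (Suc n) (f, g) (K # Ks) z =
     D (fst K) (snd K) (g Ks z) - g Ks (tri (fst K) (snd K) z) - slide K (\<lambda>Ks. g Ks z) Ks
     - delta_II sV tri theta D n (\<lambda>Ks. f (K # Ks), \<lambda>Ks. g (K # Ks)) Ks z"
  using assms act_sum_Cons[OF assms, of "\<lambda>Ks. g Ks z" K]
  unfolding delta_II_def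
  by (simp add: alt_sum_Cons(1) sum_negf omit_Cons algebra_simps split: prod.splits del: sum.lessThan_Suc)

lemma fst_slide: "fst (slide K F Ks) = slide K (\<lambda>Ks. fst (F Ks)) Ks"
  and snd_slide: "snd (slide K F Ks) z = slide K (\<lambda>Ks. snd (F Ks) z) Ks"
  by (induction Ks arbitrary: F) simp_all

text \<open>Both sides obey Cartan's formula in the first argument, and for one argument both are
  \<open>right_act\<close>.\<close>

lemma pack_delta:
  assumes "length Ks = n + 1"
  shows "(delta_I sV br tri rho D n c Ks, delta_II sV tri theta D n c Ks) = cobd (pack c) Ks"
  using assms
proof (induction n arbitrary: Ks c)
  case 0
  then obtain K where "Ks = [K]" by (auto simp: length_Suc_conv)
  then show ?case
    by (auto simp: delta_I_def delta_II_def right_act_def pack_def omit_def fun_eq_iff split: prod.splits)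
next
  case (Suc n)
  then obtain K Ls where Ks: "Ks = K # Ls" "length Ls = n + 1" "Ls \<noteq> []"
    by (auto simp: length_Suc_conv)
  obtain f g where c: "c = (f, g)" by fastforce
  have "pack (\<lambda>Ks. f (K # Ks), \<lambda>Ks. g (K # Ks)) = (\<lambda>Ks. pack c (K # Ks))"
    by (simp add: pack_def c fun_eq_iff)
  then have "cobd (\<lambda>Ks. pack c (K # Ks)) Ls = 
    (delta_I sV br tri rho D n (\<lambda>Ks. f (K # Ks), \<lambda>Ks. g (K # Ks)) Ls,
     delta_II sV tri theta D n (\<lambda>Ks. f (K # Ks), \<lambda>Ks. g (K # Ks)) Ls)"
    using Suc.IH[OF Ks(2), of "(\<lambda>Ks. f (K # Ks), \<lambda>Ks. g (K # Ks))"] by simp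
  then show ?case
    unfolding Ks(1) cobd_Cons[OF Ks(3)]
    by (auto simp: c delta_I_Cons[OF Ks(2)] delta_II_Cons[OF Ks(2)] lie_der_def prod_eq_iff fun_eq_iff
        fst_slide snd_slide left_act_def pack_def algebra_simps split: prod.splits)
qed

lemma pack_LY_delta:
  assumes "n \<ge> 1" "\<And>Ks. length Ks \<noteq> n - 1 \<Longrightarrow> pack c Ks = 0"
  shows "pack (LY_delta sV br tri rho theta D n c) = cobd (pack c)"
proof
  fix Ks :: "('l \<times> 'l) list"
  show "pack (LY_delta sV br tri rho theta D n c) Ks = cobd (pack c) Ks"
  proof (cases "length Ks = n")
    case True
    then show ?thesis using pack_delta[of Ks "n - 1" c] assms(1) by (simp add: pack_def LY_delta_def)
  next
    case False
    \<comment> \<open>At a wrong length the explicit formulas default to \<open>0\<close>, whereas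
      \<open>cobd\<close> vanishes because \<open>c\<close> does so on lists one shorter.\<close>
    then have "cobd (pack c) Ks = cobd (\<lambda>Ks. 0) Ks"
      using assms(1) by (intro cobd_cong assms(2)) auto
    moreover have "length Ks \<noteq> n - 1 + 1" using False assms(1) by simp
    ultimately show ?thesis
      by (simp add: pack_def LY_delta_def delta_I_def delta_II_def cobd_zero prod_eq_iff fun_eq_iff)
  qed
qed

lemma LY_delta_C_LY:
  assumes "n \<ge> 1" "c \<in> C_LY sL sV n"
  shows "LY_delta sV br tri rho theta D n c \<in> C_LY sL sV (n + 1)"
proof -
  have "pack (LY_delta sV br tri rho theta D n c) Ks = 0" if "length Ks \<noteq> n" for Ks
    using that assms(1)
    by (cases n) (auto simp: pack_def LY_delta_def delta_I_def delta_II_def zero_prod_def fun_eq_iff)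
  then show ?thesis
    using assms by (auto simp: C_LY_iff pack_LY_delta multi_cobd)
qed

lemma LY_delta_LY_delta:
  assumes "n \<ge> 1" "c \<in> C_LY sL sV n"
  shows "LY_delta sV br tri rho theta D (n + 1) (LY_delta sV br tri rho theta D n c) = 0"
proof -
  let ?dd = "LY_delta sV br tri rho theta D (n + 1) (LY_delta sV br tri rho theta D n c)"
  have d: "LY_delta sV br tri rho theta D n c \<in> C_LY sL sV (n + 1)"
    using LY_delta_C_LY[OF assms] .
  then have dd: "?dd \<in> C_LY sL sV (n + 2)"
    using LY_delta_C_LY[OF _ d] by simp
  have "pack ?dd Ks = 0" for Ks
  \<comment> \<open>Degree \<open>n + 2\<close> means \<open>n + 1\<close> pairs, and
    \<open>n \<ge> 1\<close> supplies the two arguments that \<open>cobd_cobd\<close> asks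
    for.\<close>
  proof (cases "length Ks = n + 1")
    case True
    then show ?thesis using assms d by (simp add: C_LY_iff pack_LY_delta cobd_cobd)
  qed (use dd in \<open>simp add: C_LY_iff\<close>)
  then show ?thesis by (simp add: pack_def prod_eq_iff fun_eq_iff)
qed

section \<open>Sums and halves of cochains\<close>

lemma pack_add: "pack (c + c') Ks = pack c Ks + pack c' Ks"
  and pack_diff: "pack (c - c') Ks = pack c Ks - pack c' Ks"
  by (simp_all add: pack_def fun_eq_iff)

lemma pack_inject: "pack c = pack c' \<longleftrightarrow> c = c'"
  by (auto simp: pack_def fun_eq_iff prod_eq_iff)

lemma C_LY_add:
  assumes "c \<in> C_LY sL sV n" "c' \<in> C_LY sL sV n"
  shows "c + c' \<in> C_LY sL sV n"
  using assms unfolding C_LY_iff multi_def pack_add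
  by (auto intro!: bialt_plus linear_snd_plus(1) simp del: snd_add)

lemma C_LY_diff:
  assumes "c \<in> C_LY sL sV n" "c' \<in> C_LY sL sV n"
  shows "c - c' \<in> C_LY sL sV n"
  using assms unfolding C_LY_iff multi_def pack_diff
  by (auto intro!: bialt_minus linear_snd_plus(2) simp del: snd_diff)

lemma C_LY_zero: "0 \<in> C_LY sL sV n"
proof -
  have "pack 0 = (\<lambda>Ks. 0)" by (simp add: pack_def fun_eq_iff prod_eq_iff)
  then show ?thesis by (auto simp: C_LY_iff multi_def intro: bialt_zero linear_snd_plus(3)[simplified])
qed

lemma LY_delta_add:
  assumes "n \<ge> 1" "c \<in> C_LY sL sV n" "c' \<in> C_LY sL sV n"
  shows "LY_delta sV br tri rho theta D n (c + c') =
    LY_delta sV br tri rho theta D n c + LY_delta sV br tri rho theta D n c'"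
proof -
  have "pack (LY_delta sV br tri rho theta D n (c + c')) = cobd (\<lambda>Ks. pack c Ks + pack c' Ks)"
    using C_LY_add[OF assms(2,3)] assms(1)
    by (simp add: C_LY_iff pack_LY_delta pack_add[abs_def])
  also have "\<dots> = pack (LY_delta sV br tri rho theta D n c + LY_delta sV br tri rho theta D n c')"
    using assms by (simp add: C_LY_iff pack_LY_delta pack_add cobd_add fun_eq_iff)
  finally show ?thesis by (simp add: pack_inject)
qed

lemma LY_delta_diff:
  assumes "n \<ge> 1" "c \<in> C_LY sL sV n" "c' \<in> C_LY sL sV n"
  shows "LY_delta sV br tri rho theta D n (c - c') =
    LY_delta sV br tri rho theta D n c - LY_delta sV br tri rho theta D n c'"
  using LY_delta_add[OF assms(1) C_LY_diff[OF assms(2,3)] assms(3)] by simp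

text \<open>\<open>Phi_double\<close> exhibits twice \<open>Phi\<close> as a difference of cochains;
  this transfers the cochain property to \<open>Phi\<close>.\<close>

lemma C_LY_halve:
  assumes "c + c \<in> C_LY sL sV n"
  shows "c \<in> C_LY sL sV n"
proof -
  have half: "pack c Ks = pair_scale sV (1 / 2) (pack (c + c) Ks)" for Ks
    by (auto simp: pack_def pair_scale_def V.scale_right_distrib fun_eq_iff simp flip: V.scale_left_distrib)
  have mlin: "mlin (\<lambda>x. pair_scale sV a (G x))" if "mlin G" for a G
    using that by (auto simp: mlin_def pair_scale_add) (simp add: pair_scale_def mult.commute)
  have "bialt (\<lambda>P. pair_scale sV a (B P))" if "bialt B" for a B
    using that by (auto simp: bialt_def mlin pair_scale_zero)
  moreover have "Vector_Spaces.linear sL sV (snd (pair_scale sV a m))"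
    if "Vector_Spaces.linear sL sV (snd m)" for a m
    using that by (auto simp: pair_scale_def Vector_Spaces.linear_iff V.scale_right_distrib mult.commute)
  ultimately have "multi (pack c)"
    using assms unfolding C_LY_iff multi_def half by blast
  moreover have "pack c Ks = 0" if "length Ks \<noteq> n - 1" for Ks
    using assms that unfolding half C_LY_iff by (simp add: pair_scale_zero)
  moreover have "fst c = 0" if "n = 1"
  proof -
    have "fst c Ks + fst c Ks = 0 + 0" for Ks
      using assms that by (auto simp: C_LY_iff fun_eq_iff)
    then have "fst c Ks = 0" for Ks
      using char_0_double_cancel[OF V.vector_space_axioms] by metis
    then show ?thesis by (simp add: fun_eq_iff)
  qed
  ultimately show ?thesis by (simp add: C_LY_iff)
qed

end

section \<open>Functoriality\<close>

definition push :: "('v \<Rightarrow> 'w) \<Rightarrow> ('l \<Rightarrow> 'm) \<Rightarrow> ('m, 'v) cochain \<Rightarrow> ('l, 'w) cochain" where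
  "push \<psi> \<phi> c = (\<lambda>Ks. \<psi> (fst c (map (map_prod \<phi> \<phi>) Ks)),
                \<lambda>Ks z. \<psi> (snd c (map (map_prod \<phi> \<phi>) Ks) (\<phi> z)))"

lemma map_omit: "map h (omit k Ks) = omit k (map h Ks)"
  by (simp add: omit_def take_map drop_map)

text \<open>\<open>\<phi>\<close> leads from the primed algebra to the unprimed one and
  \<open>\<psi>\<close> from the unprimed coefficients to the primed ones; every structure map is
  carried across separately.\<close>

lemma LY_delta_push:
  assumes \<psi>: "Vector_Spaces.linear sV sV' \<psi>"
    and "\<And>x y. \<phi> (br' x y) = br (\<phi> x) (\<phi> y)"
    and "\<And>x y z. \<phi> (tri' x y z) = tri (\<phi> x) (\<phi> y) (\<phi> z)"
    and "\<And>x u. rho' x (\<psi> u) = \<psi> (rho (\<phi> x) u)"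
    and "\<And>x y u. theta' x y (\<psi> u) = \<psi> (theta (\<phi> x) (\<phi> y) u)"
    and "\<And>x y u. D' x y (\<psi> u) = \<psi> (D (\<phi> x) (\<phi> y) u)"
  shows "LY_delta sV' br' tri' rho' theta' D' n (push \<psi> \<phi> c) =
           push \<psi> \<phi> (LY_delta sV br tri rho theta D n c)"
proof -
  have act: "act_omit tri' (\<lambda>Ks. \<psi> (F (map (map_prod \<phi> \<phi>) Ks))) k l Ks =
      \<psi> (act_omit tri F k l (map (map_prod \<phi> \<phi>) Ks))"
    if "k < l" "l < length Ks" for k l Ks F
    using that
    by (auto simp: act_omit_def map_omit map_update assms linear_add[OF \<psi>] split: prod.splits)
  have "delta_I sV' br' tri' rho' D' m (push \<psi> \<phi> c) Ks =
      \<psi> (delta_I sV br tri rho D m c (map (map_prod \<phi> \<phi>) Ks))" for m Ks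
    by (cases c; cases "Ks ! m")
      (auto simp: delta_I_def push_def linear_maps[OF \<psi>] linear_sum[OF \<psi>] act assms take_map map_omit
        intro!: sum.cong)
  moreover have "delta_II sV' tri' theta' D' m (push \<psi> \<phi> c) Ks z =
      \<psi> (delta_II sV tri theta D m c (map (map_prod \<phi> \<phi>) Ks) (\<phi> z))" for m Ks z
    using act[where F="\<lambda>Ks. snd c Ks (\<phi> z)"]
    by (cases c; cases "Ks ! m")
      (auto simp: delta_II_def push_def linear_maps[OF \<psi>] linear_sum[OF \<psi>] assms take_map map_omit
        intro!: sum.cong)
  ultimately show ?thesis
    by (simp add: LY_delta_def push_def fun_eq_iff)
qed

lemma linear_comp:
  assumes "Vector_Spaces.linear s1 s2 f" "Vector_Spaces.linear s2 s3 g"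
  shows "Vector_Spaces.linear s1 s3 (\<lambda>x. g (f x))"
  using Vector_Spaces.linear_compose[OF assms] by (simp add: o_def)

lemma (in ly_representation) push_C_LY:
  assumes "Vector_Spaces.linear sV sV \<psi>" "Vector_Spaces.linear sL sL \<phi>" "c \<in> C_LY sL sV n"
  shows "push \<psi> \<phi> c \<in> C_LY sL sV n"
proof -
  have "(\<lambda>Ks. \<psi> (f (map (map_prod \<phi> \<phi>) Ks))) \<in> wedge_hom sL sV m" if "f \<in> wedge_hom sL sV m" for f m
  proof -
    have "Vector_Spaces.linear sL sV (\<lambda>x. f (Ks @ (x, y) # Ks'))"
      "Vector_Spaces.linear sL sV (\<lambda>x. f (Ks @ (y, x) # Ks'))" for Ks Ks' y
      using that by (auto simp: wedge_hom_iff)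
    from this[THEN linear_comp[OF assms(2)], THEN linear_comp, OF assms(1)]
    show ?thesis
      using that by (auto simp: wedge_hom_iff linear_zero[OF assms(1)])
  qed
  note wedge = this
  have linear: "Vector_Spaces.linear sL sV (\<lambda>z. \<psi> (g (\<phi> z)))" if "Vector_Spaces.linear sL sV g" for g
    using linear_comp[OF linear_comp[OF assms(2) that] assms(1)] .
  obtain f g where c: "c = (f, g)" by fastforce
  have "(\<lambda>Ks. \<psi> (g (map (map_prod \<phi> \<phi>) Ks) (\<phi> z))) \<in> wedge_hom sL sV (n - 1)" for z
    using assms(3) by (intro wedge[of "\<lambda>Ks. g Ks (\<phi> z)"]) (auto simp: C_LY_def wedge_hom1_def c)
  then show ?thesis
    using assms(3) unfolding C_LY_def push_def wedge_hom1_def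
    by (auto simp: c linear_zero[OF assms(1)] zero_fun_def wedge linear)
qed

section \<open>The operator complex\<close>

context modified_rb_ly_representation
begin

text \<open>
  \<open>Rp\<close> and \<open>Rm\<close> are homomorphisms from the induced algebra to the original one, and they are
  jointly injective. Dually, \<open>Vp\<close> and \<open>Vm\<close> are homomorphisms to the induced representation from the
  original one, pulled back along \<open>Rm\<close> and \<open>Rp\<close> respectively, and they are jointly surjective.
\<close>

definition Rp :: "'l \<Rightarrow> 'l" where "Rp x = R x + x"
definition Rm :: "'l \<Rightarrow> 'l" where "Rm x = R x - x"
definition Vp :: "'v \<Rightarrow> 'v" where "Vp u = RV u + u"
definition Vm :: "'v \<Rightarrow> 'v" where "Vm u = RV u - u"

lemmas R_maps = linear_maps[OF R_linear]
lemmas RV_maps = linear_maps[OF RV_linear]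

lemma Rp_linear: "Vector_Spaces.linear sL sL Rp"
  and Rm_linear: "Vector_Spaces.linear sL sL Rm"
  by (intro linearI vector_space_axioms; simp add: Rp_def Rm_def R_maps scale_right_distrib
      scale_right_diff_distrib)+

lemma Vp_linear: "Vector_Spaces.linear sV sV Vp"
  and Vm_linear: "Vector_Spaces.linear sV sV Vm"
  by (intro V.linearI V.vector_space_axioms; simp add: Vp_def Vm_def RV_maps V.scale_right_distrib
      V.scale_right_diff_distrib)+

lemmas Rp_maps = linear_maps[OF Rp_linear]
lemmas Rm_maps = linear_maps[OF Rm_linear]
lemmas Vp_maps = linear_maps[OF Vp_linear]
lemmas Vm_maps = linear_maps[OF Vm_linear]

lemma R_eqI:
  assumes "Rp x = Rp y" "Rm x = Rm y"
  shows "x = y"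
proof -
  have "x + x = Rp x - Rm x" "y + y = Rp y - Rm y" by (simp_all add: Rp_def Rm_def)
  then show ?thesis
    using assms char_0_double_cancel[OF vector_space_axioms] by metis
qed

text \<open>Since \<open>u + u = Vp u - Vm u\<close>, additive maps are determined by their values
  on the two images.\<close>

lemma V_eqI:
  assumes "\<And>u v. f (u + v) = f u + f v" "\<And>u v. f (u - v) = f u - f v"
    and "\<And>u v. g (u + v) = g u + g v" "\<And>u v. g (u - v) = g u - g v"
    and "\<And>u. f (Vp u) = g (Vp u)" "\<And>u. f (Vm u) = g (Vm u)"
  shows "f u = (g u :: 'v)"
proof -
  have "u + u = Vp u - Vm u" by (simp add: Vp_def Vm_def)
  then have "f u + f u = g u + g u" using assms by metis
  then show ?thesis by (rule char_0_double_cancel[OF V.vector_space_axioms])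
qed

text \<open>The modified Rota-Baxter identity says that \<open>R\<close> sends the induced bracket
  to \<open>br (R x) (R y) + br x y\<close>; adding or subtracting the induced bracket completes the
  product.\<close>

lemma br_hom: "Rp (br_R br R x y) = br (Rp x) (Rp y)" "Rm (br_R br R x y) = br (Rm x) (Rm y)"
  by (simp_all add: Rp_def Rm_def br_R_def br_maps R_br algebra_simps R_maps)

lemma tri_hom:
  "Rp (tri_R tri R x y z) = tri (Rp x) (Rp y) (Rp z)"
  "Rm (tri_R tri R x y z) = tri (Rm x) (Rm y) (Rm z)"
  by (simp_all add: Rp_def Rm_def tri_R_def tri_maps R_tri algebra_simps R_maps)

text \<open>\<open>RV_rho\<close> cancels \<open>RV (rho x (RV u))\<close> and leaves
  \<open>rho (R x) u\<close> and \<open>rho x u\<close> with opposite signs for \<open>Vp\<close>,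
  hence \<open>Rm\<close>; for \<open>Vm\<close> it is \<open>Rp\<close>.\<close>

lemma rho_hom:
  "rho_R rho R RV x (Vp u) = Vp (rho (Rm x) u)"
  "rho_R rho R RV x (Vm u) = Vm (rho (Rp x) u)"
  by (simp_all add: Rp_def Rm_def Vp_def Vm_def rho_R_def rho_maps RV_rho algebra_simps RV_maps)

text \<open>As \<open>Vp\<close> and \<open>Vm\<close> are jointly surjective, these equations
  determine \<open>theta_R\<close>.\<close>

lemma theta_hom:
  "theta_R theta R RV x y (Vp u) = Vp (theta (Rm x) (Rm y) u)"
  "theta_R theta R RV x y (Vm u) = Vm (theta (Rp x) (Rp y) u)"
  by (simp_all add: Rp_def Rm_def Vp_def Vm_def theta_R_def theta_maps RV_theta algebra_simps RV_maps)

text \<open>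
  The compatibility of \<open>R\<^sub>V\<close> with \<open>D\<close> is not an axiom; by (R1) it reduces to that with the curvature of
  \<open>\<rho>\<close>. The latter follows by applying \<open>\<rho>(Rp x) Vp = Vp \<sigma>(x)\<close> and \<open>\<rho>(Rm x) Vm = Vm \<sigma>(x)\<close> twice and
  separating the two results, where \<open>\<sigma>(x) = \<rho>(Rx) + \<rho>(x) R\<^sub>V\<close>.
\<close>

lemma RV_D:
  "D (R x) (R y) (RV u) =
     RV (D (R x) (R y) u + D (R x) y (RV u) + D x (R y) (RV u) + D x y u)
     - D (R x) y u - D x y (RV u) - D x (R y) u"
proof -
  define E where "E x y u = rho x (rho y u) - rho y (rho x u) - rho (br x y) u" for x y u
  define \<sigma> where "\<sigma> x u = rho (R x) u + rho x (RV u)" for x u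
  define m where "m = \<sigma> x (\<sigma> y u) - \<sigma> y (\<sigma> x u) - \<sigma> (br_R br R x y) u"
  have E_maps: "E (x + x') y u = E x y u + E x' y u" "E x (y + y') u = E x y u + E x y' u"
    "E x y (u + u') = E x y u + E x y u'" "E (x - x') y u = E x y u - E x' y u"
    "E x (y - y') u = E x y u - E x y' u" "E x y (u - u') = E x y u - E x y u'"
    for x x' y y' u u'
    by (simp_all add: E_def rho_maps br_maps algebra_simps)
  have \<sigma>: "rho (Rp x) (Vp u) = Vp (\<sigma> x u)" "rho (Rm x) (Vm u) = Vm (\<sigma> x u)" for x u
    by (simp_all add: Rp_def Rm_def Vp_def Vm_def \<sigma>_def rho_maps RV_rho algebra_simps RV_maps)
  \<comment> \<open>Reading \<open>br_hom\<close> from right to left lets \<open>\<sigma>\<close> be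
    pulled through the bracket term of \<open>E\<close> as well.\<close>
  have "E (Rp x) (Rp y) (Vp u) = Vp m" "E (Rm x) (Rm y) (Vm u) = Vm m"
    by (simp_all add: E_def m_def \<sigma> Vp_maps Vm_maps flip: br_hom)
  then have 1: "E (R x + x) (R y + y) (RV u + u) = RV m + m"
    and 2: "E (R x - x) (R y - y) (RV u - u) = RV m - m"
    by (simp_all add: Rp_def Rm_def Vp_def Vm_def)
  \<comment> \<open>Half the difference of the two equations computes \<open>m\<close>, and half
    their sum computes \<open>RV m\<close>; comparing the two is the claim for
    \<open>E\<close>.\<close>
  have "m + m = (RV m + m) - (RV m - m)" by simp
  also have "\<dots> = (E (R x) (R y) u + E x y u + E (R x) y (RV u) + E x (R y) (RV u))
      + (E (R x) (R y) u + E x y u + E (R x) y (RV u) + E x (R y) (RV u))"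
    unfolding 1[symmetric] 2[symmetric] E_maps by (simp add: algebra_simps)
  finally have m: "m = E (R x) (R y) u + E x y u + E (R x) y (RV u) + E x (R y) (RV u)"
    by (rule char_0_double_cancel[OF V.vector_space_axioms])
  have "RV m + RV m = (RV m + m) + (RV m - m)" by simp
  also have "\<dots> = (E (R x) (R y) (RV u) + E x y (RV u) + E (R x) y u + E x (R y) u)
      + (E (R x) (R y) (RV u) + E x y (RV u) + E (R x) y u + E x (R y) u)"
    unfolding 1[symmetric] 2[symmetric] E_maps by (simp add: algebra_simps)
  finally have "RV m = E (R x) (R y) (RV u) + E x y (RV u) + E (R x) y u + E x (R y) u"
    by (rule char_0_double_cancel[OF V.vector_space_axioms])
  then have E: "E (R x) (R y) (RV u) =
      RV (E (R x) (R y) u + E (R x) y (RV u) + E x (R y) (RV u) + E x y u)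
      - E (R x) y u - E x y (RV u) - E x (R y) u"
    unfolding m by (simp add: algebra_simps RV_maps)
  have D: "D x y u = theta y x u - theta x y u + E x y u" for x y u
    by (simp add: D_conv E_def)
  show ?thesis
    by (simp add: D E RV_theta RV_maps algebra_simps)
qed

lemma D_hom:
  "D_R D R RV x y (Vp u) = Vp (D (Rm x) (Rm y) u)"
  "D_R D R RV x y (Vm u) = Vm (D (Rp x) (Rp y) u)"
  by (simp_all add: Rp_def Rm_def Vp_def Vm_def D_R_def D_maps RV_D algebra_simps RV_maps)

text \<open>After applying \<open>Rp\<close> or \<open>Rm\<close>, each identity becomes an axiom of
  the original algebra; \<open>R_eqI\<close> then concludes.\<close>

lemma induced_lie_yamaguti: "lie_yamaguti sL (br_R br R) (tri_R tri R)"
proof (intro lie_yamaguti.intro lie_yamaguti_axioms.intro vector_space_axioms)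
  fix x y z a b
  note homs = br_hom tri_hom Rp_maps Rm_maps
  show "Vector_Spaces.linear sL sL (\<lambda>x. br_R br R x y)" "Vector_Spaces.linear sL sL (\<lambda>y. br_R br R x y)"
    "Vector_Spaces.linear sL sL (\<lambda>x. tri_R tri R x y z)" "Vector_Spaces.linear sL sL (\<lambda>y. tri_R tri R x y z)"
    "Vector_Spaces.linear sL sL (\<lambda>z. tri_R tri R x y z)"
    by (intro linearI vector_space_axioms;
        simp add: br_R_def tri_R_def br_maps tri_maps R_maps scale_right_distrib)+
  show "br_R br R x y = - br_R br R y x"
    by (rule R_eqI; simp add: homs; rule LY1)
  show "tri_R tri R x y z = - tri_R tri R y x z"
    by (rule R_eqI; simp add: homs; rule LY2)
  show "br_R br R (br_R br R x y) z + br_R br R (br_R br R y z) x + br_R br R (br_R br R z x) y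
      + tri_R tri R x y z + tri_R tri R y z x + tri_R tri R z x y = 0"
    by (rule R_eqI; simp add: homs LY3)
  show "tri_R tri R (br_R br R x y) z a + tri_R tri R (br_R br R z x) y a
      + tri_R tri R (br_R br R y z) x a = 0"
    by (rule R_eqI; simp add: homs LY4)
  show "tri_R tri R a b (br_R br R x y) =
      br_R br R (tri_R tri R a b x) y + br_R br R x (tri_R tri R a b y)"
    by (rule R_eqI; simp add: homs; rule LY5)
  show "tri_R tri R a b (tri_R tri R x y z) = tri_R tri R (tri_R tri R a b x) y z
      + tri_R tri R x (tri_R tri R a b y) z + tri_R tri R x y (tri_R tri R a b z)"
    by (rule R_eqI; simp add: homs; rule LY6)
qed

lemma induced_linear:
  "Vector_Spaces.linear sV sV (rho_R rho R RV x)"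
  "Vector_Spaces.linear sV sV (theta_R theta R RV x y)"
  "Vector_Spaces.linear sV sV (D_R D R RV x y)"
  "Vector_Spaces.linear sL sV (\<lambda>x. rho_R rho R RV x u)"
  "Vector_Spaces.linear sL sV (\<lambda>x. theta_R theta R RV x y u)"
  "Vector_Spaces.linear sL sV (\<lambda>y. theta_R theta R RV x y u)"
  "Vector_Spaces.linear sL sV (\<lambda>x. D_R D R RV x y u)"
  "Vector_Spaces.linear sL sV (\<lambda>y. D_R D R RV x y u)"
  by (intro V.linearI vector_space_axioms V.vector_space_axioms;
      simp add: rho_R_def theta_R_def D_R_def rho_maps theta_maps D_maps R_maps RV_maps
        V.scale_right_distrib V.scale_right_diff_distrib)+

text \<open>The identities are additive in \<open>u\<close>, so they are tested on
  \<open>Vp u\<close> and \<open>Vm u\<close>, where they become the original axioms at the images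
  under \<open>Rm\<close> and \<open>Rp\<close>.\<close>

lemma induced_representation:
  "ly_representation sL (br_R br R) (tri_R tri R) sV (rho_R rho R RV) (theta_R theta R RV) (D_R D R RV)"
proof -
  let ?rho = "rho_R rho R RV" and ?theta = "theta_R theta R RV" and ?D = "D_R D R RV"
  let ?br = "br_R br R" and ?tri = "tri_R tri R"
  note homs = br_hom tri_hom rho_hom theta_hom D_hom
  note maps = induced_linear(1-3)[THEN linear_add] induced_linear(1-3)[THEN linear_diff]
  show ?thesis
  proof (intro ly_representation.intro ly_representation_axioms.intro induced_lie_yamaguti
      V.vector_space_axioms)
    fix x y z a b u
    show "?D x y u - ?theta y x u + ?theta x y u + ?rho (?br x y) u
        - ?rho x (?rho y u) + ?rho y (?rho x u) = 0"
      by (rule V_eqI[where u=u]) (simp_all add: maps homs D_conv[of "Rp _"] D_conv[of "Rm _"] Vp_maps Vm_maps)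
    show "?D (?br x y) z u + ?D (?br y z) x u + ?D (?br z x) y u = 0"
      by (rule V_eqI[where u=u])
        (simp_all add: maps homs R2 Vp_linear[THEN linear_zero] Vm_linear[THEN linear_zero]
          flip: Vp_linear[THEN linear_add] Vm_linear[THEN linear_add])
    show "?theta (?br x y) a u = ?theta x a (?rho y u) - ?theta y a (?rho x u)"
      by (rule V_eqI[where u=u]) (simp_all add: maps homs R3 Vp_maps Vm_maps)
    show "?D a b (?rho x u) = ?rho x (?D a b u) + ?rho (?tri a b x) u"
      by (rule V_eqI[where u=u]) (simp_all add: maps homs R4 Vp_maps Vm_maps)
    show "?theta x (?br a b) u = ?rho a (?theta x b u) - ?rho b (?theta x a u)"
      by (rule V_eqI[where u=u]) (simp_all add: maps homs R5 Vp_maps Vm_maps)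
    show "?D a b (?theta x y u) =
        ?theta x y (?D a b u) + ?theta (?tri a b x) y u + ?theta x (?tri a b y) u"
      by (rule V_eqI[where u=u]) (simp_all add: maps homs R6 Vp_maps Vm_maps)
    show "?theta a (?tri x y z) u =
        ?theta y z (?theta a x u) - ?theta x z (?theta a y u) + ?D x y (?theta a z u)"
      by (rule V_eqI[where u=u]) (simp_all add: maps homs R7 Vp_maps Vm_maps)
  qed (rule induced_linear)+
qed

text \<open>Results on \<open>\<delta>\<close> become available for \<open>\<partial>\<close>, which
  is \<open>LY_delta\<close> of this structure.\<close>

sublocale induced: ly_representation sL "br_R br R" "tri_R tri R" sV
    "rho_R rho R RV" "theta_R theta R RV" "D_R D R RV"
  by (rule induced_representation)

end

section \<open>The comparison map\<close>

lemma sum_Pow_lessThan_Suc: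
  "(\<Sum>S\<in>Pow {..<Suc k}. h S) = (\<Sum>S\<in>Pow {..<k}. h S + (h (insert k S) :: 'b::comm_monoid_add))"
proof -
  have "inj_on (insert k) (Pow {..<k})"
    by (rule inj_onI) (auto simp: insert_ident)
  moreover have "Pow {..<k} \<inter> insert k ` Pow {..<k} = {}" by auto
  ultimately show ?thesis
    by (simp add: lessThan_Suc Pow_insert sum.union_disjoint sum.reindex sum.distrib)
qed

lemma apply_pairs_snoc:
  "apply_pairs R S (Ks @ [P]) =
     apply_pairs R S Ks @ [(apply_at R S (2 * length Ks) (fst P), apply_at R S (2 * length Ks + 1) (snd P))]"
  by (simp add: apply_pairs_def nth_append)

lemma apply_pairs_insert:
  "k \<ge> 2 * length Ks \<Longrightarrow> apply_pairs R (insert k S) Ks = apply_pairs R S Ks"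
  by (auto simp: apply_pairs_def apply_at_def)

lemma length_apply_pairs: "length (apply_pairs R S Ks) = length Ks"
  by (simp add: apply_pairs_def)

context modified_rb_ly_representation
begin

text \<open>Multilinear expansion at \<open>R + e\<close>. The term with \<open>R\<close> at the
  positions in \<open>S\<close> carries one factor \<open>e\<close> for each position outside
  \<open>S\<close>; as the number of positions is even and \<open>e * e = 1\<close>, this is
  \<open>e ^ card S\<close>.\<close>

lemma sum_apply_pairs:
  assumes "e * e = 1"
    and "\<And>Ks Ks' y. Vector_Spaces.linear sL sV (\<lambda>x. f (Ks @ (x, y) # Ks'))"
    and "\<And>Ks Ks' x. Vector_Spaces.linear sL sV (\<lambda>y. f (Ks @ (x, y) # Ks'))"
  defines "\<phi> \<equiv> \<lambda>x. R x + sL e x"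
  shows "(\<Sum>S\<in>Pow {..<2 * length Ks}. sV (e ^ card S) (f (apply_pairs R S Ks))) =
           f (map (map_prod \<phi> \<phi>) Ks)"
  using assms(2,3)
proof (induction Ks arbitrary: f rule: rev_induct)
  case Nil
  then show ?case by (simp add: apply_pairs_def)
next
  case (snoc P Ks)
  obtain p q where P: "P = (p, q)" by fastforce
  have expand: "f (Ls @ [(\<phi> p, \<phi> q)]) =
      f (Ls @ [(R p, R q)]) + sV e (f (Ls @ [(R p, q)])) + sV e (f (Ls @ [(p, R q)])) + f (Ls @ [(p, q)])"
    for Ls
    unfolding \<phi>_def
    by (simp add: snoc.prems[of Ls _ "[]", THEN linear_add] snoc.prems[of Ls _ "[]", THEN linear_scale]
        assms(1) V.scale_right_distrib algebra_simps)
  let ?m = "2 * length Ks"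
  have "(\<Sum>S\<in>Pow {..<2 * length (Ks @ [P])}. sV (e ^ card S) (f (apply_pairs R S (Ks @ [P])))) =
     (\<Sum>S\<in>Pow {..<?m}. sV (e ^ card S) (f (apply_pairs R S Ks @ [(\<phi> p, \<phi> q)])))"
  proof -
    \<comment> \<open>Four classes of subsets, by which of the positions \<open>?m\<close> and
      \<open>Suc ?m\<close> of the last pair they contain.\<close>
    have "sV (e ^ card S) (f (apply_pairs R S (Ks @ [P])))
        + sV (e ^ card (insert (Suc ?m) S)) (f (apply_pairs R (insert (Suc ?m) S) (Ks @ [P])))
        + (sV (e ^ card (insert ?m S)) (f (apply_pairs R (insert ?m S) (Ks @ [P])))
           + sV (e ^ card (insert (Suc ?m) (insert ?m S)))
               (f (apply_pairs R (insert (Suc ?m) (insert ?m S)) (Ks @ [P]))))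
        = sV (e ^ card S) (f (apply_pairs R S Ks @ [(\<phi> p, \<phi> q)]))"
      if "S \<subseteq> {..<?m}" for S
    proof -
      have S: "finite S" "?m \<notin> S" "Suc ?m \<notin> S"
        using that finite_subset by auto
      then have "apply_pairs R S (Ks @ [P]) = apply_pairs R S Ks @ [(p, q)]"
        "apply_pairs R (insert ?m S) (Ks @ [P]) = apply_pairs R S Ks @ [(R p, q)]"
        "apply_pairs R (insert (Suc ?m) S) (Ks @ [P]) = apply_pairs R S Ks @ [(p, R q)]"
        "apply_pairs R (insert (Suc ?m) (insert ?m S)) (Ks @ [P]) = apply_pairs R S Ks @ [(R p, R q)]"
        by (simp_all add: apply_pairs_snoc apply_pairs_insert P apply_at_def)
      moreover have "e * (e * a) = a" for a
        using assms(1) by (simp flip: mult.assoc)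
      ultimately show ?thesis
        using S by (simp add: assms(1) expand V.scale_right_distrib mult.commute algebra_simps)
    qed
    then show ?thesis
      by (simp add: sum_Pow_lessThan_Suc)
  qed
  also have "\<dots> = f (map (map_prod \<phi> \<phi>) (Ks @ [P]))"
  proof -
    have "Vector_Spaces.linear sL sV (\<lambda>x. f ((Ls @ (x, y) # Ls') @ [(\<phi> p, \<phi> q)]))"
      "Vector_Spaces.linear sL sV (\<lambda>x. f ((Ls @ (y, x) # Ls') @ [(\<phi> p, \<phi> q)]))" for Ls Ls' y
      using snoc.prems[of Ls _ "Ls' @ [(\<phi> p, \<phi> q)]"] by simp_all
    from snoc.IH[of "\<lambda>Ls. f (Ls @ [(\<phi> p, \<phi> q)])", OF this] show ?thesis
      by (simp add: P)
  qed
  finally show ?case .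
qed

lemma sum_parity:
  fixes A :: "nat set"
  assumes "finite A"
  shows "(\<Sum>S\<in>Pow A. sV (1 ^ card S) (h S)) =
      (\<Sum>S | S \<subseteq> A \<and> even (card S). h S) + (\<Sum>S | S \<subseteq> A \<and> odd (card S). h S)"
    and "(\<Sum>S\<in>Pow A. sV ((- 1) ^ card S) (h S)) =
      (\<Sum>S | S \<subseteq> A \<and> even (card S). h S) - (\<Sum>S | S \<subseteq> A \<and> odd (card S). h S)"
proof -
  have "Pow A = {S. S \<subseteq> A \<and> even (card S)} \<union> {S. S \<subseteq> A \<and> odd (card S)}" by auto
  moreover have "finite {S. S \<subseteq> A \<and> even (card S)}" "finite {S. S \<subseteq> A \<and> odd (card S)}"
    using assms by simp_all
  moreover have "{S. S \<subseteq> A \<and> even (card S)} \<inter> {S. S \<subseteq> A \<and> odd (card S)} = {}" by auto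
  ultimately have "(\<Sum>S\<in>Pow A. k S) = (\<Sum>S | S \<subseteq> A \<and> even (card S). k S)
      + (\<Sum>S | S \<subseteq> A \<and> odd (card S). k S)" for k :: "nat set \<Rightarrow> 'v"
    by (simp add: sum.union_disjoint)
  then show "(\<Sum>S\<in>Pow A. sV (1 ^ card S) (h S)) =
      (\<Sum>S | S \<subseteq> A \<and> even (card S). h S) + (\<Sum>S | S \<subseteq> A \<and> odd (card S). h S)"
    "(\<Sum>S\<in>Pow A. sV ((- 1) ^ card S) (h S)) =
      (\<Sum>S | S \<subseteq> A \<and> even (card S). h S) - (\<Sum>S | S \<subseteq> A \<and> odd (card S). h S)"
    by (simp_all add: sum_negf)
qed

text \<open>With \<open>ev\<close> and \<open>od\<close> the sums over even and odd subsets, the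
  values at \<open>Rp\<close> and \<open>Rm\<close> are \<open>ev + od\<close> and
  \<open>ev - od\<close>, and \<open>Vp (ev - od) - Vm (ev + od)\<close> is twice
  \<open>ev - RV od\<close>.\<close>

lemma Phi_I_double:
  assumes "f \<in> wedge_hom sL sV n"
  shows "Phi_I R RV n f Ks + Phi_I R RV n f Ks =
    Vp (f (map (map_prod Rm Rm) Ks)) - Vm (f (map (map_prod Rp Rp) Ks))"
proof (cases "length Ks = n")
  case True
  define ev od where "ev = (\<Sum>S | S \<subseteq> {..<2 * n} \<and> even (card S). f (apply_pairs R S Ks))"
    and "od = (\<Sum>S | S \<subseteq> {..<2 * n} \<and> odd (card S). f (apply_pairs R S Ks))"
  have *: "Rp = (\<lambda>x. R x + sL 1 x)" "Rm = (\<lambda>x. R x + sL (- 1) x)"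
    by (simp_all add: Rp_def Rm_def fun_eq_iff)
  have "f (map (map_prod Rp Rp) Ks) = ev + od" "f (map (map_prod Rm Rm) Ks) = ev - od"
    unfolding * ev_def od_def True[symmetric] sum_parity[OF finite_lessThan, symmetric]
    using assms by (subst sum_apply_pairs; simp add: wedge_hom_iff)+
  then show ?thesis
    by (simp add: Phi_I_def Vp_def Vm_def RV_maps flip: ev_def od_def)
next
  case False
  then have "f (map h Ks) = 0" "f (apply_pairs R S Ks) = 0" for S h
    using assms by (simp_all add: wedge_hom_def length_apply_pairs)
  then show ?thesis by (simp add: Phi_I_def RV_maps Vp_maps Vm_maps)
qed

lemma Phi_II_double:
  assumes "g \<in> wedge_hom1 sL sV n"
  shows "Phi_II R RV n g Ks z + Phi_II R RV n g Ks z =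
    Vp (g (map (map_prod Rm Rm) Ks) (Rm z)) - Vm (g (map (map_prod Rp Rp) Ks) (Rp z))"
proof (cases "length Ks = n")
  case True
  let ?g = "\<lambda>S. g (apply_pairs R S Ks) (apply_at R S (2 * n) z)"
  define ev od where "ev = (\<Sum>S | S \<subseteq> {..<2 * n + 1} \<and> even (card S). ?g S)"
    and "od = (\<Sum>S | S \<subseteq> {..<2 * n + 1} \<and> odd (card S). ?g S)"
  have g: "Vector_Spaces.linear sL sV (g Ks)" "(\<lambda>Ks. g Ks z) \<in> wedge_hom sL sV n" for Ks z
    using assms by (auto simp: wedge_hom1_def)
  have *: "Rp = (\<lambda>x. R x + sL 1 x)" "Rm = (\<lambda>x. R x + sL (- 1) x)"
    by (simp_all add: Rp_def Rm_def fun_eq_iff)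
  \<comment> \<open>The extra factor \<open>e\<close> reflects the odd number of positions; it turns
    the value at \<open>Rm\<close> into \<open>od - ev\<close> and so exchanges even and
    odd.\<close>
  have sum: "(\<Sum>S\<in>Pow {..<2 * n + 1}. sV (e ^ card S) (?g S)) =
      sV e (g (map (map_prod (\<lambda>x. R x + sL e x) (\<lambda>x. R x + sL e x)) Ks) (R z + sL e z))"
    if e: "e * e = 1" for e
  proof -
    let ?\<phi> = "\<lambda>x. R x + sL e x"
    have "sV (e ^ card S) (?g S) + sV (e ^ card (insert (2 * n) S)) (?g (insert (2 * n) S)) =
        sV e (sV (e ^ card S) (g (apply_pairs R S Ks) (?\<phi> z)))" if "S \<subseteq> {..<2 * n}" for S
    proof -
      have S: "finite S" "2 * n \<notin> S"
        using that finite_subset by auto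
      have "e * (e * a) = a" for a
        using e by (simp flip: mult.assoc)
      then show ?thesis
        using True S by (simp add: e apply_pairs_insert apply_at_def linear_add[OF g(1)] linear_scale[OF g(1)]
            V.scale_right_distrib mult.left_commute mult.commute add.commute)
    qed
    then have "(\<Sum>S\<in>Pow {..<2 * n + 1}. sV (e ^ card S) (?g S)) =
        sV e (\<Sum>S\<in>Pow {..<2 * length Ks}. sV (e ^ card S) (g (apply_pairs R S Ks) (?\<phi> z)))"
      by (simp add: sum_Pow_lessThan_Suc True V.scale_sum_right)
    also have "\<dots> = sV e (g (map (map_prod ?\<phi> ?\<phi>) Ks) (?\<phi> z))"
      using g(2)[of "?\<phi> z"] e by (subst sum_apply_pairs) (simp_all add: wedge_hom_iff)
    finally show ?thesis .
  qed
  have "g (map (map_prod Rp Rp) Ks) (Rp z) = ev + od" "g (map (map_prod Rm Rm) Ks) (Rm z) = od - ev"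
    using sum[of 1] sum[of "- 1"]
    unfolding sum_parity[OF finite_lessThan] * ev_def[symmetric] od_def[symmetric]
    by (simp_all add: eq_neg_iff_add_eq_0 flip: *) (simp add: algebra_simps)
  then show ?thesis
    unfolding Phi_II_def ev_def[symmetric] od_def[symmetric]
    by (simp add: Vp_def Vm_def RV_maps)
next
  case False
  then have "g (map h Ks) y = 0" "g (apply_pairs R S Ks) y = 0" for S h y
    using assms by (auto simp: wedge_hom1_def wedge_hom_def length_apply_pairs)
  then show ?thesis by (simp add: Phi_II_def RV_maps Vp_maps Vm_maps)
qed

lemma Phi_double:
  assumes "c \<in> C_LY sL sV n"
  shows "Phi R RV n c + Phi R RV n c = push Vp Rm c - push Vm Rp c"
  using assms Phi_I_double[of "fst c" "n - 1"] Phi_II_double[of "snd c" "n - 1"]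
  by (auto simp: C_LY_def Phi_def push_def fun_eq_iff)

lemma Phi_C_LY:
  assumes "c \<in> C_LY sL sV n"
  shows "Phi R RV n c \<in> C_LY sL sV n"
  by (rule C_LY_halve)
    (simp only: Phi_double[OF assms] C_LY_diff push_C_LY[OF _ _ assms] Vp_linear Vm_linear Rp_linear Rm_linear)

lemma cochain_double_cancel:
  fixes c c' :: "('l, 'v) cochain"
  assumes "c + c = c' + c'"
  shows "c = c'"
proof -
  have "fst c Ks + fst c Ks = fst c' Ks + fst c' Ks" "snd c Ks z + snd c Ks z = snd c' Ks z + snd c' Ks z"
    for Ks z
    using assms by (auto simp: prod_eq_iff fun_eq_iff)
  from this[THEN char_0_double_cancel[OF V.vector_space_axioms]] show ?thesis
    by (simp add: prod_eq_iff fun_eq_iff)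
qed

lemma Phi_chain_map:
  assumes "n \<ge> 1" "c \<in> C_LY sL sV n"
  shows "MRBO_partial sV br tri R rho theta D RV n (Phi R RV n c) =
           Phi R RV (n + 1) (LY_delta sV br tri rho theta D n c)"
proof (rule cochain_double_cancel)
  let ?\<delta> = "LY_delta sV br tri rho theta D n" and ?d = "MRBO_partial sV br tri R rho theta D RV n"
  note Phi = Phi_C_LY[OF assms(2)]
  have "?d (Phi R RV n c) + ?d (Phi R RV n c) = ?d (Phi R RV n c + Phi R RV n c)"
    unfolding MRBO_partial_def by (rule induced.LY_delta_add[OF assms(1) Phi Phi, symmetric])
  also have "\<dots> = ?d (push Vp Rm c) - ?d (push Vm Rp c)"
    unfolding Phi_double[OF assms(2)] MRBO_partial_def
    by (intro induced.LY_delta_diff assms push_C_LY Vp_linear Vm_linear Rp_linear Rm_linear)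
  also have "?d (push Vp Rm c) = push Vp Rm (?\<delta> c)"
    unfolding MRBO_partial_def by (intro LY_delta_push Vp_linear br_hom tri_hom rho_hom theta_hom D_hom)
  also have "?d (push Vm Rp c) = push Vm Rp (?\<delta> c)"
    unfolding MRBO_partial_def by (intro LY_delta_push Vm_linear br_hom tri_hom rho_hom theta_hom D_hom)
  also have "push Vp Rm (?\<delta> c) - push Vm Rp (?\<delta> c) = Phi R RV (n + 1) (?\<delta> c) + Phi R RV (n + 1) (?\<delta> c)"
    by (rule Phi_double[OF LY_delta_C_LY[OF assms], symmetric])
  finally show "?d (Phi R RV n c) + ?d (Phi R RV n c) =
      Phi R RV (n + 1) (?\<delta> c) + Phi R RV (n + 1) (?\<delta> c)" .
qed

section \<open>The mapping cone differential\<close>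

lemma MRBLY_d_C_MRBLY:
  assumes "n \<ge> 1" "c \<in> C_MRBLY sL sV n"
  shows "MRBLY_d sV br tri R rho theta D RV n c \<in> C_MRBLY sL sV (n + 1)"
proof -
  obtain c1 c2 where c1: "c = (c1, c2)" by (rule prod.exhaust)
  then have c: "c = (c1, c2)" "c1 \<in> C_LY sL sV n" "n \<noteq> 1 \<Longrightarrow> c2 \<in> C_LY sL sV (n - 1)"
    using assms(2) by (simp_all add: C_MRBLY_def)
  have "MRBO_partial sV br tri R rho theta D RV (n - 1) c2 \<in> C_LY sL sV n" if "n \<noteq> 1"
    using induced.LY_delta_C_LY[OF _ c(3)] that assms(1) by (simp add: MRBO_partial_def)
  then show ?thesis
    using assms(1) c C_LY_zero Phi_C_LY[OF c(2)] LY_delta_C_LY[OF _ c(2)]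
    by (auto simp: MRBLY_d_def C_MRBLY_def C_LY_diff C_LY_diff[of 0, simplified])
qed

lemma MRBLY_d_MRBLY_d:
  assumes "n \<ge> 1" "c \<in> C_MRBLY sL sV n"
  shows "MRBLY_d sV br tri R rho theta D RV (n + 1) (MRBLY_d sV br tri R rho theta D RV n c) = 0"
proof -
  let ?\<delta> = "LY_delta sV br tri rho theta D" and ?d = "MRBO_partial sV br tri R rho theta D RV"
  obtain c1 c2 where c1: "c = (c1, c2)" by (rule prod.exhaust)
  then have c: "c = (c1, c2)" "c1 \<in> C_LY sL sV n" "n \<noteq> 1 \<Longrightarrow> c2 \<in> C_LY sL sV (n - 1)"
    using assms(2) by (simp_all add: C_MRBLY_def)
  note Phi = Phi_C_LY[OF c(2)]
  \<comment> \<open>With this \<open>x\<close>, the second entry of the differential is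
    \<open>x - Phi R RV n c1\<close> in degree \<open>1\<close> as well.\<close>
  define x where "x = (if n = 1 then 0 else - ?d (n - 1) c2)"
  have d0: "?d n 0 = 0"
    using induced.LY_delta_diff[OF assms(1) C_LY_zero C_LY_zero] by (simp add: MRBO_partial_def)
  have x: "x \<in> C_LY sL sV n \<and> ?d n x = 0"
  proof (cases "n = 1")
    case True
    then have "x = 0" by (simp add: x_def)
    then show ?thesis using d0 C_LY_zero by simp
  next
    case False
    then have n: "n - 1 \<ge> 1" "n - 1 + 1 = n" using assms(1) by auto
    have 1: "?d (n - 1) c2 \<in> C_LY sL sV n"
      using induced.LY_delta_C_LY[OF n(1) c(3)[OF False]] unfolding n(2) MRBO_partial_def .
    have "?d n (?d (n - 1) c2) = 0"
      using induced.LY_delta_LY_delta[OF n(1) c(3)[OF False]] unfolding n(2) MRBO_partial_def .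
    moreover have "?d n (0 - ?d (n - 1) c2) = ?d n 0 - ?d n (?d (n - 1) c2)"
      using induced.LY_delta_diff[OF assms(1) C_LY_zero 1[unfolded MRBO_partial_def]]
      unfolding MRBO_partial_def .
    moreover have "x = 0 - ?d (n - 1) c2" using False by (simp add: x_def)
    ultimately show ?thesis using C_LY_diff[OF C_LY_zero 1] d0 by simp
  qed
  \<comment> \<open>The second entry of the double differential is \<open>- ?d n (x - Phi R RV n c1)
    - Phi R RV (n + 1) (?\<delta> n c1)\<close>; the chain map property makes it vanish.\<close>
  have "?d n (x - Phi R RV n c1) = ?d n x - ?d n (Phi R RV n c1)"
    unfolding MRBO_partial_def using x by (intro induced.LY_delta_diff assms(1) Phi) simp
  then have "?d n (x - Phi R RV n c1) = - Phi R RV (n + 1) (?\<delta> n c1)"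
    using x Phi_chain_map[OF assms(1) c(2)] by simp
  moreover have "MRBLY_d sV br tri R rho theta D RV n c = (?\<delta> n c1, x - Phi R RV n c1)"
    by (simp add: MRBLY_d_def c(1) x_def)
  ultimately show ?thesis
    using assms(1) LY_delta_LY_delta[OF assms(1) c(2)]
    by (simp add: MRBLY_d_def zero_prod_def)
qed

end

theorem theorem5p5:
  fixes sL :: "'k::{alg_closed_field,field_char_0} \<Rightarrow> 'l::ab_group_add \<Rightarrow> 'l"
    and sV :: "'k \<Rightarrow> 'v::ab_group_add \<Rightarrow> 'v"
    and br :: "'l \<Rightarrow> 'l \<Rightarrow> 'l"
    and tri :: "'l \<Rightarrow> 'l \<Rightarrow> 'l \<Rightarrow> 'l"
    and R :: "'l \<Rightarrow> 'l"
    and rho :: "'l \<Rightarrow> 'v \<Rightarrow> 'v"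
    and theta D :: "'l \<Rightarrow> 'l \<Rightarrow> 'v \<Rightarrow> 'v"
    and RV :: "'v \<Rightarrow> 'v"
    and n :: nat
  assumes "modified_rb_ly_representation sL br tri R sV rho theta D RV"
    and "n \<ge> 1"
  shows "(\<forall>c \<in> C_MRBLY sL sV n.
             MRBLY_d sV br tri R rho theta D RV n c \<in> C_MRBLY sL sV (n + 1)) \<and>
         (\<forall>c \<in> C_MRBLY sL sV n.
             MRBLY_d sV br tri R rho theta D RV (n + 1)
               (MRBLY_d sV br tri R rho theta D RV n c) = 0)"
proof -
  interpret modified_rb_ly_representation sL br tri R sV rho theta D RV by fact
  show ?thesis
    using MRBLY_d_C_MRBLY[OF assms(2)] MRBLY_d_MRBLY_d[OF assms(2)] by blast
qed

end
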